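(* Let $\beta=\frac{1}{\lambda_1A^2}$ if $\lambda_0A=1$ and $\beta=0$ otherwise. For every momentum $k>0$, the on-shell scattering matrix $\mathcal{S}^\varepsilon(k)$ of the pair $(-\Delta^\varepsilon,-\Delta_0)$ converges as $\varepsilon\to0$ to the on-shell scattering matrix $\mathcal{S}(k)$ of $(-\Delta_\beta,-\Delta_0)$, whose entries are \[ \mathcal{S}_{ij}(k)=\frac2n-\delta_{ij}-\frac{2\mathrm{i}k\beta\,\Pi_{ij}}{1+\mathrm{i}k\beta B}; \] moreover there is a constant $C$ (depending on $k$) such that $\|\mathcal{S}^\varepsilon(k)-\mathcal{S}(k)\|\le C\varepsilon$ for all $\varepsilon\in(0,1]$, where $\|\cdot\|$ is the operator norm of an $n\times n$ matrix.
   Context: $\Gamma$ is a star graph with $n\ge 2$ semi-infinite edges $\gamma_1,\dots,\gamma_n$, each identified with $[0,\infty)$ with coordinate $x_i$; $\psi_i$ is the restriction of $\psi$ to $\gamma_i$, $\psi_i'(0)$ the outward derivative at the vertex, $\langle f,g\rangle_\Gamma=\sum_i\int_0^\infty f_i\bar g_i\,\mathrm{d}x_i$, $H^2(\Gamma)=\bigoplus_iH^2(0,\infty)$, and $K(\Gamma)$ the set of $\psi$ continuous at the vertex with $\sum_i\psi_i'(0)=0$. $-\Delta_0$ is $-\mathrm{d}^2/\mathrm{d}x^2$ on each edge with domain $H^2(\Gamma)\cap K(\Gamma)$. $V:\Gamma\to\mathbb{R}$ is locally integrable, supported in $\{x_i\in[0,1]\}$ on each edge, with $\int_\Gamma V\,\mathrm{d}x=0$;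 $V_\varepsilon(x)=V(x/\varepsilon)$. $\lambda$ is holomorphic near $0$, real for real $\varepsilon$, with $\lambda(\varepsilon)=\lambda_0+\varepsilon\lambda_1+O(\varepsilon^2)$, $\lambda_0,\lambda_1\in\mathbb{R}\setminus\{0\}$. For $\varepsilon\in(0,1]$, $-\Delta^\varepsilon=-\frac{\mathrm{d}^2}{\mathrm{d}x^2}+\frac{\lambda(\varepsilon)}{\varepsilon^3}V_\varepsilon\langle\cdot,V_\varepsilon\rangle_\Gamma$ with domain $H^2(\Gamma)\cap K(\Gamma)$. Define $\vartheta_i=\int_0^\infty x_iV(x_i)\,\mathrm{d}x_i$ (pairwise distinct), $A=-\sum_{i=1}^n\int_0^\infty\!\int_0^\infty\min\{x_i,y_i\}V(x_i)V(y_i)\,\mathrm{d}x_i\,\mathrm{d}y_i$, $B=\frac1n(\sum_i\vartheta_i)^2-\sum_i\vartheta_i^2$, and $\Pi_{ij}=(\frac1n\sum_\ell\vartheta_\ell-\vartheta_i)(\frac1n\sum_\ell\vartheta_\ell-\vartheta_j)$. The operator $-\Delta_\beta$ acts as $-\psi''$ on each edge on $\psi\in H^2(\Gamma)$ with $\frac{\psi_i(0)-\psi_j(0)}{\vartheta_i-\vartheta_j}=\beta\sum_\ell\vartheta_\ell\psi_\ell'(0)$ ($i<j$) and $\sum_\ell\psi_\ell'(0)=0$. Scattering matrices: for $k>0$ and incoming edge $i$, $\mathcal{S}^\varepsilon_{ij}(k)$ is defined by the solution $\psi$ of $-\psi''+\frac{\lambda(\varepsilon)}{\varepsilon^3}V_\varepsilon\langle\psi,V_\varepsilon\rangle_\Gamma=k^2\psi$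 on $\Gamma$ (edgewise locally $H^2$, satisfying the conditions of $K(\Gamma)$) of the form $\psi_j(x_j)=\delta_{ij}e^{-\mathrm{i}kx_j}+\mathcal{S}^\varepsilon_{ij}(k)e^{\mathrm{i}kx_j}$ for $x_j\ge1$, $j=1,\dots,n$; $\mathcal{S}_{ij}(k)$ is defined analogously for $-\Delta_\beta$ by requiring $\psi_j(x_j)=\delta_{ij}e^{-\mathrm{i}kx_j}+\mathcal{S}_{ij}(k)e^{\mathrm{i}kx_j}$ for all $x_j\ge0$ to satisfy the vertex conditions of $-\Delta_\beta$.
   Formalization: Solutions defining S^ε need only a locally absolutely continuous derivative on each edge, not local H²; for V in L² the two agree, while for V merely locally integrable an H² solution generally does not exist. *)

theory Defs
  imports "HOL-Analysis.Analysis" "HOL-Library.Landau_Symbols"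
begin

text \<open>Star graph with edges indexed by a finite type 'n (n = CARD('n)).
  A function on the graph is psi :: 'n => real => complex, psi j being the
  restriction to edge j (coordinate x >= 0). Derivatives at the vertex are
  the one-sided derivatives d/dx at x = 0 along each edge.\<close>

definition graph_inner :: "('n::finite \<Rightarrow> real \<Rightarrow> complex) \<Rightarrow> ('n \<Rightarrow> real \<Rightarrow> real) \<Rightarrow> complex" where
  "graph_inner psi W = (\<Sum>j\<in>UNIV. LBINT x:{0..}. psi j x * complex_of_real (W j x))"

definition edge_deriv :: "(real \<Rightarrow> complex) \<Rightarrow> real \<Rightarrow> complex" where
  "edge_deriv f x = vector_derivative f (at x within {0..})"

text \<open>psi is a generalized solution of
  -psi'' + c V_eps <psi, V_eps> = k^2 psi  (c = lambda(eps)/eps^3)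
  on the graph (edgewise C^1 with absolutely continuous derivative satisfying
  the equation, continuity and Kirchhoff condition at the vertex), with
  incoming wave on edge i and outgoing amplitudes s on [1,oo).\<close>
definition is_eps_scat_solution ::
  "('n::finite \<Rightarrow> real \<Rightarrow> real) \<Rightarrow> real \<Rightarrow> real \<Rightarrow> real \<Rightarrow> 'n \<Rightarrow> ('n \<Rightarrow> real \<Rightarrow> complex) \<Rightarrow> complex^'n \<Rightarrow> bool" where
  "is_eps_scat_solution V c eps k i psi s \<longleftrightarrow>
    (let Ve = (\<lambda>j x. V j (x / eps)); a = graph_inner psi Ve in
      (\<forall>j. set_integrable lborel {0..} (\<lambda>x. psi j x * complex_of_real (Ve j x))) \<and>
      (\<forall>j. \<forall>x\<ge>0. psi j differentiable (at x within {0..})) \<and>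
      (\<forall>j. \<forall>x\<ge>0.
         set_integrable lborel {0..x}
           (\<lambda>t. complex_of_real (c * Ve j t) * a - complex_of_real (k\<^sup>2) * psi j t) \<and>
         edge_deriv (psi j) x = edge_deriv (psi j) 0 +
           (LBINT t:{0..x}. complex_of_real (c * Ve j t) * a - complex_of_real (k\<^sup>2) * psi j t)) \<and>
      (\<forall>j l. psi j 0 = psi l 0) \<and>
      (\<Sum>j\<in>UNIV. edge_deriv (psi j) 0) = 0 \<and>
      (\<forall>j. \<forall>x\<ge>1. psi j x = (if j = i then exp (- \<i> * k * x) else 0) + s $ j * exp (\<i> * k * x)))"

text \<open>S is (the) on-shell scattering matrix of (-Delta^eps, -Delta_0) at momentum k;
  row i corresponds to the incoming edge i: S $ i $ j = S_ij.\<close>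
definition is_eps_scat_matrix ::
  "('n::finite \<Rightarrow> real \<Rightarrow> real) \<Rightarrow> real \<Rightarrow> real \<Rightarrow> real \<Rightarrow> complex^'n^'n \<Rightarrow> bool" where
  "is_eps_scat_matrix V c eps k S \<longleftrightarrow> (\<forall>i. \<exists>psi. is_eps_scat_solution V c eps k i psi (S $ i))"

definition is_beta_scat_matrix ::
  "('n::finite \<Rightarrow> real) \<Rightarrow> real \<Rightarrow> real \<Rightarrow> complex^'n^'n \<Rightarrow> bool" where
  "is_beta_scat_matrix th \<beta> k S \<longleftrightarrow>
    (\<forall>i. let psi = (\<lambda>j x. (if j = i then exp (- \<i> * k * x) else 0) + S $ i $ j * exp (\<i> * k * x));
             d = (\<lambda>j. edge_deriv (psi j) 0) in
       (\<forall>a b. a \<noteq> b \<longrightarrow>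
          (psi a 0 - psi b 0) / complex_of_real (th a - th b) = complex_of_real \<beta> * (\<Sum>l\<in>UNIV. complex_of_real (th l) * d l)) \<and>
       (\<Sum>l\<in>UNIV. d l) = 0)"

definition theta :: "('n::finite \<Rightarrow> real \<Rightarrow> real) \<Rightarrow> 'n \<Rightarrow> real" where
  "theta V i = (LBINT x:{0..}. x * V i x)"

definition A_const :: "('n::finite \<Rightarrow> real \<Rightarrow> real) \<Rightarrow> real" where
  "A_const V = - (\<Sum>i\<in>UNIV. LBINT x:{0..}. LBINT y:{0..}. min x y * V i x * V i y)"

definition B_const :: "('n::finite \<Rightarrow> real) \<Rightarrow> real" where
  "B_const th = (\<Sum>i\<in>UNIV. th i)\<^sup>2 / real CARD('n) - (\<Sum>i\<in>UNIV. (th i)\<^sup>2)"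

definition Pi_mat :: "('n::finite \<Rightarrow> real) \<Rightarrow> 'n \<Rightarrow> 'n \<Rightarrow> real" where
  "Pi_mat th i j = ((\<Sum>l\<in>UNIV. th l) / real CARD('n) - th i) * ((\<Sum>l\<in>UNIV. th l) / real CARD('n) - th j)"

definition scat_limit :: "('n::finite \<Rightarrow> real) \<Rightarrow> real \<Rightarrow> real \<Rightarrow> complex^'n^'n" where
  "scat_limit th \<beta> k = (\<chi> i j. complex_of_real (2 / real CARD('n)) - (if i = j then 1 else 0)
      - 2 * \<i> * k * \<beta> * Pi_mat th i j / (1 + \<i> * k * \<beta> * B_const th))"

end

theory Submission
  imports Defs
begin

text \<open>
  The perturbation has rank one, so on each edge a scattering solution is a free solution plus \<open>\<alpha>\<close> times
  the Duhamel integral of \<open>V(\<cdot>/\<epsilon>)\<close>, where \<open>\<alpha> = c a\<close> and \<open>a\<close> is the inner product with the potential.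
  Matching at the vertex and at infinity leaves one scalar equation \<open>a (1 + c M) = R\<^sub>i\<close>, and
  \<open>S\<^sub>i\<^sub>j = 2/n - \<delta>\<^sub>i\<^sub>j - \<i> c R\<^sub>i R\<^sub>j / (2k (1 + c M))\<close>, where \<open>R\<close> and \<open>M\<close> are built from the sine and cosine
  moments and the self-interaction of the potential. As \<open>|R\<^sub>i|\<^sup>2 \<le> 4k Im M\<close>, the entries are bounded for all \<open>\<epsilon>\<close>,
  which leaves only small \<open>\<epsilon>\<close>. There, rescaling gives
  \<open>R\<^sub>i = 2\<i>k\<epsilon>\<^sup>2(mean \<theta> - \<theta>\<^sub>i) + O(\<epsilon>\<^sup>3)\<close> and \<open>M = -\<epsilon>\<^sup>3 A - \<i>k\<epsilon>\<^sup>4 B + O(\<epsilon>\<^sup>5)\<close>, so with \<open>c = \<lambda>(\<epsilon>)/\<epsilon>\<^sup>3\<close> the correction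
  is \<open>O(\<epsilon>)\<close> unless \<open>\<lambda>\<^sub>0 A = 1\<close>, when the denominator is itself of order \<open>\<epsilon>\<close> and a limit survives.
\<close>

section \<open>Duhamel kernels of the free equation\<close>

text \<open>The potential is only integrable, so expansions are made in the trigonometric kernels
  and never in the potential, and derivatives of the Duhamel term come from integral identities. Two
  cancellations fix the orders. Mean zero over the whole graph removes the order \<epsilon> part of
  the summed moments, although a single edge may have nonzero mean. The products of edge mean and
  \<theta> that appear at order \<epsilon>^3 in the sine-cosine terms of \<open>response\<close> are
  removed by the self-interaction, because max(x - t, 0) = x - min(x, t), and only A is left. In the
  resonant case the coefficient of \<epsilon> in the denominator tends to - \<open>lam1\<close> A -
  i k \<open>lam0\<close> B, whose real part is nonzero. Nothing prevents the denominator from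
  vanishing at other values of \<epsilon>. There every source vanishes too, so the amplitude a is
  undetermined while the scattering matrix is not, and the convention x / 0 = 0 gives its correct
  entries. Existence and uniqueness of the matrix therefore hold for every \<epsilon> in
  (0,1].\<close>

lemma integrable_kernel_times_product:
  fixes K :: "real \<times> real \<Rightarrow> real" and f g :: "real \<Rightarrow> real"
  assumes K [measurable]: "K \<in> borel_measurable (lborel \<Otimes>\<^sub>M lborel)"
    and bound: "\<And>p. \<bar>K p\<bar> \<le> b"
    and f: "integrable lborel f" and g: "integrable lborel g"
  shows "integrable (lborel \<Otimes>\<^sub>M lborel) (\<lambda>(x, y). K (x, y) * (f x * g y))"
proof -
  have [measurable]: "f \<in> borel_measurable lborel" "g \<in> borel_measurable lborel"
    using f g by auto
  have prod: "integrable (lborel \<Otimes>\<^sub>M lborel) (\<lambda>p. b * (f (fst p) * g (snd p)))"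
  proof (rule integrable_mult_right, rule lborel_pair.Fubini_integrable)
    show "(\<lambda>p. f (fst p) * g (snd p)) \<in> borel_measurable (lborel \<Otimes>\<^sub>M lborel)" by measurable
    show "integrable lborel (\<lambda>x. LBINT y. norm (f (fst (x, y)) * g (snd (x, y))))"
      using f by (simp add: abs_mult)
    show "AE x in lborel. integrable lborel (\<lambda>y. f (fst (x, y)) * g (snd (x, y)))"
      using g by simp
  qed
  show ?thesis
  proof (rule Bochner_Integration.integrable_bound[OF prod])
    show "(\<lambda>(x, y). K (x, y) * (f x * g y)) \<in> borel_measurable (lborel \<Otimes>\<^sub>M lborel)"
      by measurable
    have "\<bar>K p\<bar> \<le> \<bar>b\<bar>" for p
      using bound[of p] by simp
    then show "AE p in lborel \<Otimes>\<^sub>M lborel.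
        norm (case p of (x, y) \<Rightarrow> K (x, y) * (f x * g y)) \<le> norm (b * (f (fst p) * g (snd p)))"
      by (intro AE_I2) (simp add: abs_mult mult_right_mono split: prod.split)
  qed
qed

section \<open>Convolution of an integrable function with a bounded kernel\<close>

definition convolve :: "(real \<Rightarrow> real) \<Rightarrow> (real \<Rightarrow> real) \<Rightarrow> real \<Rightarrow> real" where
  "convolve \<kappa> h x = (LBINT t. \<kappa> (x - t) * h t)"

lemma integrable_bounded_times:
  fixes f h :: "real \<Rightarrow> real"
  assumes "f \<in> borel_measurable borel" "\<And>s. \<bar>f s\<bar> \<le> b" "integrable lborel h"
  shows "integrable lborel (\<lambda>t. f t * h t)"
proof (rule Bochner_Integration.integrable_bound[OF integrable_mult_right[OF assms(3), of b]])
  show "(\<lambda>t. f t * h t) \<in> borel_measurable lborel"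
    using assms by measurable
  have "\<bar>f s\<bar> \<le> \<bar>b\<bar>" for s
    using assms(2)[of s] by simp
  then show "AE t in lborel. norm (f t * h t) \<le> norm (b * h t)"
    by (intro AE_I2) (simp add: abs_mult mult_right_mono)
qed

lemma integrable_convolve:
  fixes \<kappa> h :: "real \<Rightarrow> real"
  assumes [measurable]: "\<kappa> \<in> borel_measurable borel" and "\<And>s. \<bar>\<kappa> s\<bar> \<le> b" "integrable lborel h"
  shows "integrable lborel (\<lambda>t. \<kappa> (x - t) * h t)"
  by (rule integrable_bounded_times[of _ b]) (use assms in auto)

text \<open>Fubini moves the integration over \<open>s\<close> onto the kernel, which is explicit,
  so integrability of \<open>h\<close> suffices. The indicator of \<open>{0..x}\<close> serves as
  the first integrable factor.\<close>

lemma convolve_interval_integral: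
  fixes \<kappa> h :: "real \<Rightarrow> real"
  assumes \<kappa> [measurable]: "\<kappa> \<in> borel_measurable borel" and b: "\<And>s. \<bar>\<kappa> s\<bar> \<le> b"
    and h: "integrable lborel h"
  shows "set_integrable lborel {0..x} (convolve \<kappa> h)"
    and "(LBINT s:{0..x}. convolve \<kappa> h s) = (LBINT t. (LBINT s:{0..x}. \<kappa> (s - t)) * h t)"
proof -
  have ind: "integrable lborel (indicator {0..x} :: real \<Rightarrow> real)"
    by (intro integrable_real_indicator) (auto simp: emeasure_lborel_Icc_eq)
  have "(\<lambda>p. \<kappa> (fst p - snd p)) \<in> borel_measurable (lborel \<Otimes>\<^sub>M lborel)"
    by measurable
  from integrable_kernel_times_product[OF this _ ind h, of b] b
  have int: "integrable (lborel \<Otimes>\<^sub>M lborel) (\<lambda>(s, t). \<kappa> (s - t) * (indicator {0..x} s * h t))"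
    by simp
  have eq: "(LBINT t. \<kappa> (s - t) * (indicator {0..x} s * h t)) = indicator {0..x} s *\<^sub>R convolve \<kappa> h s" for s
    by (simp add: convolve_def mult_ac flip: integral_mult_right_zero)
  show "set_integrable lborel {0..x} (convolve \<kappa> h)"
    using lborel_pair.integrable_fst'[OF int] by (simp add: eq set_integrable_def)
  have "(LBINT s:{0..x}. convolve \<kappa> h s) = (LBINT s. LBINT t. \<kappa> (s - t) * (indicator {0..x} s * h t))"
    by (simp add: eq set_lebesgue_integral_def)
  also have "\<dots> = (LBINT t. LBINT s. \<kappa> (s - t) * (indicator {0..x} s * h t))"
    using lborel_pair.Fubini_integral[OF int] by simp
  also have "\<dots> = (LBINT t. (LBINT s:{0..x}. \<kappa> (s - t)) * h t)"
    by (simp add: set_lebesgue_integral_def mult_ac flip: integral_mult_left_zero)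
  finally show "(LBINT s:{0..x}. convolve \<kappa> h s) = (LBINT t. (LBINT s:{0..x}. \<kappa> (s - t)) * h t)" .
qed

text \<open>The causal Green's function of d^2/dx^2 + k^2. With the cutoff inside the kernel the
  Duhamel integral runs over the whole line, and Fubini meets no variable limits.\<close>

definition sin_kernel :: "real \<Rightarrow> real \<Rightarrow> real" where
  "sin_kernel k s = (if 0 \<le> s then sin (k * s) / k else 0)"

text \<open>The derivative of \<open>sin_kernel\<close> away from 0. Its jump at 0 is what returns
  the forcing when the equation is integrated.\<close>

definition cos_kernel :: "real \<Rightarrow> real \<Rightarrow> real" where
  "cos_kernel k s = (if 0 \<le> s then cos (k * s) else 0)"

lemma measurable_kernels [measurable]:
  "sin_kernel k \<in> borel_measurable borel" "cos_kernel k \<in> borel_measurable borel"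
  unfolding sin_kernel_def cos_kernel_def by measurable

lemma sin_kernel_bound: "k > 0 \<Longrightarrow> \<bar>sin_kernel k s\<bar> \<le> 1 / k"
  by (simp add: sin_kernel_def divide_right_mono)

lemma cos_kernel_bound: "\<bar>cos_kernel k s\<bar> \<le> 1"
  by (simp add: cos_kernel_def)

text \<open>Only \<open>s \<ge> t\<close> contributes, and \<open>0 \<le> t\<close> keeps the lower
  limit 0 from cutting into that range, so the fundamental theorem on \<open>{t..x}\<close>
  applies.\<close>

lemma integral_shifted_kernel:
  fixes \<kappa> f F :: "real \<Rightarrow> real"
  assumes "0 \<le> t" "\<And>s. s < 0 \<Longrightarrow> \<kappa> s = 0" "\<And>s. 0 \<le> s \<Longrightarrow> \<kappa> s = f s"
    "\<And>s. (F has_real_derivative f s) (at s)" "\<And>s. isCont f s"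
  shows "(LBINT s:{0..x}. \<kappa> (s - t)) = (if t \<le> x then F (x - t) - F 0 else (0::real))"
proof (cases "t \<le> x")
  case True
  have "(LBINT s:{0..x}. \<kappa> (s - t)) = (LBINT s. f (s - t) * indicator {t..x} s)"
    unfolding set_lebesgue_integral_def
    by (rule Bochner_Integration.integral_cong) (use assms(1-3) True in \<open>auto simp: indicator_def\<close>)
  also have "\<dots> = F (x - t) - F (t - t)"
  proof (rule integral_FTC_Icc_real[OF True])
    show "((\<lambda>s. F (s - t)) has_real_derivative f (s - t)) (at s)" for s
      using DERIV_shift[of F "f (s - t)" s "- t"] assms(4)[of "s - t"] by simp
    show "isCont (\<lambda>s. f (s - t)) s" for s
      by (intro continuous_intros isCont_o2[OF _ assms(5)])
  qed
  finally show ?thesis using True by simp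
next
  case False
  then have "(\<lambda>s. indicator {0..x} s *\<^sub>R \<kappa> (s - t)) = (\<lambda>s. 0)"
    using assms(2) by (auto simp: indicator_def)
  then show ?thesis using False unfolding set_lebesgue_integral_def by simp
qed

lemma integral_cos_kernel:
  assumes "k > 0" "0 \<le> t"
  shows "(LBINT s:{0..x}. cos_kernel k (s - t)) = sin_kernel k (x - t)"
proof -
  have "((\<lambda>s. sin (k * s) / k) has_real_derivative cos (k * s)) (at s)" for s
    using assms by (auto intro!: derivative_eq_intros)
  from integral_shifted_kernel[OF assms(2) _ _ this, of "cos_kernel k"] show ?thesis
    by (simp add: cos_kernel_def sin_kernel_def)
qed

text \<open>The term 1 is the boundary value of the cosine primitive at \<open>s = t\<close>; paired
  with \<open>h\<close> it becomes the integral of \<open>h\<close> over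
  \<open>{0..x}\<close>.\<close>

lemma integral_sin_kernel:
  assumes "k > 0" "0 \<le> t"
  shows "k\<^sup>2 * (LBINT s:{0..x}. sin_kernel k (s - t)) = (if t \<le> x then 1 else 0) - cos_kernel k (x - t)"
proof -
  have "((\<lambda>s. - cos (k * s) / k\<^sup>2) has_real_derivative sin (k * s) / k) (at s)" for s
    using assms by (auto intro!: derivative_eq_intros simp: power2_eq_square)
  from integral_shifted_kernel[OF assms(2) _ _ this, of "sin_kernel k"] show ?thesis
    using assms by (simp add: cos_kernel_def sin_kernel_def field_simps)
qed

section \<open>Indefinite integrals on the closed half-line\<close>

lemma has_vector_derivative_indefinite:
  fixes f :: "real \<Rightarrow> 'b::euclidean_space"
  assumes cont: "continuous_on {0..} f" and "0 \<le> x"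
    and F: "\<And>x. 0 \<le> x \<Longrightarrow> F x = c + (LBINT s:{0..x}. f s)"
  shows "(F has_vector_derivative f x) (at x within {0..})"
proof -
  have cont': "continuous_on {0..u} f" for u
    by (rule continuous_on_subset[OF cont]) auto
  have "((\<lambda>u. c + integral {0..u} f) has_vector_derivative f x) (at x within {0..x+1})"
    using integral_has_vector_derivative[OF cont'[of "x + 1"], of x] \<open>0 \<le> x\<close>
    by (auto intro!: derivative_eq_intros)
  then have "(F has_vector_derivative f x) (at x within {0..x+1})"
  proof (rule has_vector_derivative_transform[rotated 2])
    show "x \<in> {0..x+1}" using \<open>0 \<le> x\<close> by simp
    show "F u = c + integral {0..u} f" if "u \<in> {0..x+1}" for u
      using F[of u] set_borel_integral_eq_integral(2)[OF borel_integrable_atLeastAtMost'[OF cont'[of u]]] that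
      by simp
  qed
  \<comment> \<open>Near \<open>x\<close> the two sets coincide, so the compact-interval theorem
    also covers the one-sided derivative at 0.\<close>
  moreover have "at x within {0..x+1} = at x within {0..}"
    by (rule at_within_nhd[of x "{..<x+1}"]) (use \<open>0 \<le> x\<close> in auto)
  ultimately show ?thesis by simp
qed

lemma continuous_on_indefinite:
  fixes f :: "real \<Rightarrow> 'b::euclidean_space"
  assumes "\<And>x. set_integrable lborel {0..x} f"
  shows "continuous_on {0..} (\<lambda>x. LBINT s:{0..x}. f s)"
proof -
  have "continuous_on {0..b} (\<lambda>x. LBINT s:{0..x}. f s)" for b
    using indefinite_integral_continuous_1[of f 0 b] set_borel_integral_eq_integral[OF assms]
    by simp
  then have "continuous (at x within {0..x+1}) (\<lambda>x. LBINT s:{0..x}. f s)" if "0 \<le> x" for x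
    using that by (simp add: continuous_on_eq_continuous_within)
  moreover have "at x within {0..x+1} = at x within {0..}" if "0 \<le> x" for x :: real
    by (rule at_within_nhd[of x "{..<x+1}"]) (use that in auto)
  ultimately show ?thesis
    by (simp add: continuous_on_eq_continuous_within)
qed

section \<open>The Duhamel integral of an integrable forcing\<close>

context
  fixes k :: real and h :: "real \<Rightarrow> real"
  assumes k: "k > 0" and h: "integrable lborel h" and supp: "\<forall>t<0. h t = 0"
begin

text \<open>With u the sine convolution and u' the cosine convolution, this is u'' + k^2 u = h
  integrated once from 0, a form that makes sense for integrable \<open>h\<close> and in which the
  graph equation is posed.\<close>

lemma convolve_cos_kernel:
  "convolve (cos_kernel k) h x = (LBINT t:{0..x}. h t) - k\<^sup>2 * (LBINT t:{0..x}. convolve (sin_kernel k) h t)"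
proof -
  have hx: "integrable lborel (\<lambda>t. indicator {0..x} t *\<^sub>R h t)"
    by (rule integrable_mult_indicator) (use h in auto)
  have hc: "integrable lborel (\<lambda>t. cos_kernel k (x - t) * h t)"
    by (rule integrable_convolve[OF _ cos_kernel_bound h]) simp
  have "k\<^sup>2 * (LBINT t:{0..x}. convolve (sin_kernel k) h t)
      = (LBINT t. k\<^sup>2 * ((LBINT s:{0..x}. sin_kernel k (s - t)) * h t))"
    using convolve_interval_integral(2)[of "sin_kernel k", OF _ sin_kernel_bound[OF k] h] by simp
  also have "\<dots> = (LBINT t. indicator {0..x} t *\<^sub>R h t - cos_kernel k (x - t) * h t)"
  proof (rule Bochner_Integration.integral_cong[OF refl])
    fix t
    show "k\<^sup>2 * ((LBINT s:{0..x}. sin_kernel k (s - t)) * h t)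
        = indicator {0..x} t *\<^sub>R h t - cos_kernel k (x - t) * h t"
    proof (cases "0 \<le> t")
      case True
      then show ?thesis
        using integral_sin_kernel[OF k True, of x] by (simp add: indicator_def left_diff_distrib flip: mult.assoc)
    qed (simp add: supp)
  qed
  also have "\<dots> = (LBINT t:{0..x}. h t) - convolve (cos_kernel k) h x"
    using hx hc by (simp add: set_lebesgue_integral_def convolve_def)
  finally show ?thesis by simp
qed

lemma convolve_sin_kernel:
  "convolve (sin_kernel k) h x = (LBINT t:{0..x}. convolve (cos_kernel k) h t)"
proof -
  have "(LBINT t:{0..x}. convolve (cos_kernel k) h t) = (LBINT t. (LBINT s:{0..x}. cos_kernel k (s - t)) * h t)"
    by (rule convolve_interval_integral(2)[OF _ cos_kernel_bound h]) simp
  also have "\<dots> = convolve (sin_kernel k) h x"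
    unfolding convolve_def
  proof (rule Bochner_Integration.integral_cong[OF refl])
    show "(LBINT s:{0..x}. cos_kernel k (s - t)) * h t = sin_kernel k (x - t) * h t" for t
      by (cases "0 \<le> t") (simp_all add: integral_cos_kernel k supp)
  qed
  finally show ?thesis by simp
qed

text \<open>The cosine kernel jumps at 0, so continuity is read off the integrated equation, whose
  right side consists of indefinite integrals.\<close>

lemma continuous_convolve_cos_kernel: "continuous_on {0..} (convolve (cos_kernel k) h)"
proof -
  have "set_integrable lborel {0..x} h" for x
    unfolding set_integrable_def by (rule integrable_mult_indicator) (use h in auto)
  moreover have "set_integrable lborel {0..x} (convolve (sin_kernel k) h)" for x
    by (rule convolve_interval_integral(1)[OF _ sin_kernel_bound[OF k] h]) simp
  ultimately show ?thesis
    unfolding convolve_cos_kernel[abs_def]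
    by (intro continuous_intros continuous_on_indefinite)
qed

lemma has_vector_derivative_convolve_sin_kernel:
  assumes "0 \<le> x"
  shows "(convolve (sin_kernel k) h has_vector_derivative convolve (cos_kernel k) h x) (at x within {0..})"
  by (rule has_vector_derivative_indefinite[where c = 0])
    (use assms continuous_convolve_cos_kernel convolve_sin_kernel in auto)

lemma convolve_kernel_0: "convolve (sin_kernel k) h 0 = 0" "convolve (cos_kernel k) h 0 = 0"
proof -
  have "(LBINT t:{0..0}. f t) = 0" for f :: "real \<Rightarrow> real"
    unfolding set_lebesgue_integral_def
    by (rule integral_eq_zero_AE, rule AE_mp[OF AE_lborel_singleton[of 0]]) (simp add: indicator_def)
  then show "convolve (sin_kernel k) h 0 = 0" "convolve (cos_kernel k) h 0 = 0"
    using convolve_cos_kernel[of 0] convolve_sin_kernel[of 0] by simp_all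
qed

text \<open>Past the support the cutoff of the kernel is not felt, and the addition theorem
  separates \<open>x\<close> from \<open>t\<close>.\<close>

lemma convolve_sin_kernel_beyond_support:
  assumes "\<And>t. t > b \<Longrightarrow> h t = 0" "b \<le> x"
  shows "convolve (sin_kernel k) h x
    = (sin (k * x) * (LBINT t. cos (k * t) * h t) - cos (k * x) * (LBINT t. sin (k * t) * h t)) / k"
proof -
  have c: "integrable lborel (\<lambda>t. cos (k * t) * h t)" and s: "integrable lborel (\<lambda>t. sin (k * t) * h t)"
    by (rule integrable_bounded_times[OF _ _ h, of _ 1]; simp)+
  have "convolve (sin_kernel k) h x
      = (LBINT t. (sin (k * x) * (cos (k * t) * h t) - cos (k * x) * (sin (k * t) * h t)) / k)"
    unfolding convolve_def
  proof (rule Bochner_Integration.integral_cong[OF refl])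
    show "sin_kernel k (x - t) * h t
        = (sin (k * x) * (cos (k * t) * h t) - cos (k * x) * (sin (k * t) * h t)) / k" for t
    proof (cases "t \<le> b")
      case True
      then show ?thesis
        using assms(2) by (simp add: sin_kernel_def right_diff_distrib sin_diff) (simp add: algebra_simps)
    qed (simp add: assms(1))
  qed
  then show ?thesis using c s by simp
qed

end

section \<open>Solutions on one edge\<close>

lemma edge_deriv_eqI:
  assumes "(f has_vector_derivative y) (at x within {0..})" "0 \<le> x"
  shows "edge_deriv f x = y"
proof -
  have "{0::real..} \<noteq> {y}" for y
    using infinite_Ici[of "0::real"] by (metis finite.emptyI finite_insert)
  then have "x islimpt {0..}"
    by (intro connected_imp_perfect) (use assms(2) in auto)
  then show ?thesis
    unfolding edge_deriv_def
    by (intro vector_derivative_within assms(1)) (simp add: trivial_limit_within)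
qed

lemma has_vector_derivative_edge_deriv:
  assumes "f differentiable (at x within {0..})"
  shows "(f has_vector_derivative edge_deriv f x) (at x within {0..})"
  using assms unfolding edge_deriv_def by (simp add: vector_derivative_works)

lemma harmonic_oscillator_unique:
  fixes \<eta> \<eta>' :: "real \<Rightarrow> complex"
  assumes k: "k > 0"
    and d1: "\<And>x. 0 \<le> x \<Longrightarrow> (\<eta> has_vector_derivative \<eta>' x) (at x within {0..})"
    and d2: "\<And>x. 0 \<le> x \<Longrightarrow> (\<eta>' has_vector_derivative - of_real (k\<^sup>2) * \<eta> x) (at x within {0..})"
    and x: "0 \<le> x"
  shows "\<eta> x = \<eta> 0 * of_real (cos (k * x)) + \<eta>' 0 * of_real (sin (k * x) / k)"
proof -
  \<comment> \<open>The pair (\<open>p\<close>, \<open>q\<close>) is (\<eta>, \<eta>'/k) rotated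
    back by the angle k x. Free motion is a rotation in this phase plane, so both are
    constant.\<close>
  define p where "p = (\<lambda>x. \<eta> x * of_real (cos (k * x)) - \<eta>' x * of_real (sin (k * x) / k))"
  define q where "q = (\<lambda>x. \<eta> x * of_real (sin (k * x)) + \<eta>' x * of_real (cos (k * x) / k))"
  have c: "((\<lambda>x. complex_of_real (cos (k * x))) has_vector_derivative of_real (- k * sin (k * x))) (at x within {0..})"
    and s: "((\<lambda>x. complex_of_real (sin (k * x))) has_vector_derivative of_real (k * cos (k * x))) (at x within {0..})"
    and c': "((\<lambda>x. complex_of_real (cos (k * x) / k)) has_vector_derivative of_real (- sin (k * x))) (at x within {0..})"
    and s': "((\<lambda>x. complex_of_real (sin (k * x) / k)) has_vector_derivative of_real (cos (k * x))) (at x within {0..})" for x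
    using k by (auto intro!: has_vector_derivative_of_real derivative_eq_intros
        simp flip: has_real_derivative_iff_has_vector_derivative)
  have dp: "(p has_vector_derivative 0) (at x within {0..})" if "0 \<le> x" for x
  proof -
    have "(p has_vector_derivative (\<eta> x * of_real (- k * sin (k * x)) + \<eta>' x * of_real (cos (k * x)))
        - (\<eta>' x * of_real (cos (k * x)) + - of_real (k\<^sup>2) * \<eta> x * of_real (sin (k * x) / k))) (at x within {0..})"
      unfolding p_def
      by (intro has_vector_derivative_diff has_vector_derivative_mult d1 d2 c s' that)
    then show ?thesis using k by (simp add: power2_eq_square field_simps)
  qed
  have dq: "(q has_vector_derivative 0) (at x within {0..})" if "0 \<le> x" for x
  proof -
    have "(q has_vector_derivative (\<eta> x * of_real (k * cos (k * x)) + \<eta>' x * of_real (sin (k * x)))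
        + (\<eta>' x * of_real (- sin (k * x)) + - of_real (k\<^sup>2) * \<eta> x * of_real (cos (k * x) / k))) (at x within {0..})"
      unfolding q_def
      by (intro has_vector_derivative_add has_vector_derivative_mult d1 d2 c' s that)
    then show ?thesis using k by (simp add: power2_eq_square field_simps)
  qed
  obtain P where P: "\<And>x. x \<in> {0..} \<Longrightarrow> p x = P"
    by (rule has_vector_derivative_zero_constant[of "{0::real..}" p]) (use dp in auto)
  obtain Q where Q: "\<And>x. x \<in> {0..} \<Longrightarrow> q x = Q"
    by (rule has_vector_derivative_zero_constant[of "{0::real..}" q]) (use dq in auto)
  have "p x = \<eta> 0" "q x = \<eta>' 0 / of_real k"
    using P[of x] P[of 0] Q[of x] Q[of 0] x by (simp_all add: p_def q_def)
  moreover have "\<eta> x = p x * of_real (cos (k * x)) + q x * of_real (sin (k * x))"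
  proof -
    have "p x * of_real (cos (k * x)) + q x * of_real (sin (k * x))
        = \<eta> x * of_real ((sin (k * x))\<^sup>2 + (cos (k * x))\<^sup>2)"
      unfolding p_def q_def of_real_add of_real_power of_real_divide
      by (simp add: algebra_simps power2_eq_square)
    then show ?thesis by simp
  qed
  ultimately show ?thesis by simp
qed

text \<open>The general solution on one edge: \<open>p\<close> is the vertex value, \<open>q\<close>
  the outward derivative there and \<open>\<alpha>\<close> the strength of the forcing.\<close>

definition edge_wave :: "real \<Rightarrow> (real \<Rightarrow> real) \<Rightarrow> complex \<Rightarrow> complex \<Rightarrow> complex \<Rightarrow> real \<Rightarrow> complex" where
  "edge_wave k h p q \<alpha> x = p * of_real (cos (k * x)) + q * of_real (sin (k * x) / k)
    + \<alpha> * of_real (convolve (sin_kernel k) h x)"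

lemma set_integrable_of_real:
  fixes f :: "real \<Rightarrow> real"
  assumes "set_integrable M A f"
  shows "set_integrable M A (\<lambda>x. complex_of_real (f x))"
proof -
  have eq: "(\<lambda>x. indicator A x *\<^sub>R complex_of_real (f x)) = (\<lambda>x. complex_of_real (indicator A x *\<^sub>R f x))"
    by (simp add: scaleR_conv_of_real)
  show ?thesis
    using assms unfolding set_integrable_def eq by (rule integrable_of_real)
qed

context
  fixes k :: real and h :: "real \<Rightarrow> real"
  assumes k: "k > 0" and h: "integrable lborel h" and supp: "\<forall>t<0. h t = 0"
begin

lemma set_integrable_forcing: "set_integrable lborel {0..x} h"
  unfolding set_integrable_def by (rule integrable_mult_indicator) (use h in auto)

lemma set_integrable_convolve_sin_kernel: "set_integrable lborel {0..x} (convolve (sin_kernel k) h)"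
  by (rule convolve_interval_integral(1)[OF _ sin_kernel_bound[OF k] h]) simp

text \<open>Passing to the difference of \<open>\<psi>\<close> and its Duhamel part leaves under the
  integral a term without the rough forcing. The potential \<open>w\<close> is tied to
  \<open>h\<close> on the half-line only, which is all that the integrals see.\<close>

lemma set_integral_forcing:
  fixes \<psi> :: "real \<Rightarrow> complex"
  assumes \<psi>: "set_integrable lborel {0..x} \<psi>" and w: "\<forall>t\<ge>0. w t = h t"
  shows "set_integrable lborel {0..x} (\<lambda>t. of_real (c * w t) * a - of_real (k\<^sup>2) * \<psi> t)"
    and "(LBINT t:{0..x}. of_real (c * w t) * a - of_real (k\<^sup>2) * \<psi> t)
      = of_real c * a * of_real (convolve (cos_kernel k) h x)
        - of_real (k\<^sup>2) * (LBINT t:{0..x}. \<psi> t - of_real c * a * of_real (convolve (sin_kernel k) h t))"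
proof -
  have eq: "indicator {0..x} t *\<^sub>R (of_real (c * w t) * a - of_real (k\<^sup>2) * \<psi> t)
      = indicator {0..x} t *\<^sub>R (of_real c * a * of_real (h t) - of_real (k\<^sup>2) * \<psi> t)" for t
    by (auto simp: indicator_def w)
  have ih: "set_integrable lborel {0..x} (\<lambda>t. of_real c * a * of_real (h t))"
    by (intro set_integrable_mult_right impI set_integrable_of_real set_integrable_forcing)
  have i\<psi>: "set_integrable lborel {0..x} (\<lambda>t. of_real (k\<^sup>2) * \<psi> t)"
    by (intro set_integrable_mult_right impI \<psi>)
  have iz: "set_integrable lborel {0..x} (\<lambda>t. of_real c * a * of_real (convolve (sin_kernel k) h t))"
    by (intro set_integrable_mult_right impI set_integrable_of_real set_integrable_convolve_sin_kernel)
  show "set_integrable lborel {0..x} (\<lambda>t. of_real (c * w t) * a - of_real (k\<^sup>2) * \<psi> t)"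
    using set_integral_diff(1)[OF ih i\<psi>] unfolding set_integrable_def eq .
  have "(LBINT t:{0..x}. of_real (c * w t) * a - of_real (k\<^sup>2) * \<psi> t)
      = (LBINT t:{0..x}. of_real c * a * of_real (h t) - of_real (k\<^sup>2) * \<psi> t)"
    unfolding set_lebesgue_integral_def eq ..
  also have "\<dots> = of_real c * a * of_real (LBINT t:{0..x}. h t) - of_real (k\<^sup>2) * (LBINT t:{0..x}. \<psi> t)"
    by (simp only: set_integral_diff(2)[OF ih i\<psi>] set_integral_mult_right set_integral_complex_of_real)
  finally have 1: "(LBINT t:{0..x}. of_real (c * w t) * a - of_real (k\<^sup>2) * \<psi> t)
      = of_real c * a * of_real (LBINT t:{0..x}. h t) - of_real (k\<^sup>2) * (LBINT t:{0..x}. \<psi> t)" .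
  have 2: "(LBINT t:{0..x}. \<psi> t - of_real c * a * of_real (convolve (sin_kernel k) h t))
      = (LBINT t:{0..x}. \<psi> t) - of_real c * a * of_real (LBINT t:{0..x}. convolve (sin_kernel k) h t)"
    by (simp only: set_integral_diff(2)[OF \<psi> iz] set_integral_mult_right set_integral_complex_of_real)
  show "(LBINT t:{0..x}. of_real (c * w t) * a - of_real (k\<^sup>2) * \<psi> t)
      = of_real c * a * of_real (convolve (cos_kernel k) h x)
        - of_real (k\<^sup>2) * (LBINT t:{0..x}. \<psi> t - of_real c * a * of_real (convolve (sin_kernel k) h t))"
    unfolding 1 2 convolve_cos_kernel[OF k h supp] by (simp add: algebra_simps)
qed

lemma has_vector_derivative_of_real_convolve:
  assumes "0 \<le> x"
  shows "((\<lambda>x. complex_of_real (convolve (sin_kernel k) h x)) has_vector_derivative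
    of_real (convolve (cos_kernel k) h x)) (at x within {0..})"
  using has_vector_derivative_convolve_sin_kernel[OF k h supp assms]
  unfolding has_real_derivative_iff_has_vector_derivative[symmetric]
  by (rule has_vector_derivative_of_real)

text \<open>The derivative of \<open>\<psi>\<close> inherits the roughness of \<open>h\<close>, but
  after subtraction of the Duhamel part it becomes an indefinite integral of a continuous function.
  Homogeneous uniqueness then applies, and the Duhamel part contributes nothing to the data at
  0.\<close>

lemma edge_equation_unique:
  fixes \<psi> :: "real \<Rightarrow> complex"
  assumes diff: "\<And>x. 0 \<le> x \<Longrightarrow> \<psi> differentiable (at x within {0..})"
    and eq: "\<And>x. 0 \<le> x \<Longrightarrow> edge_deriv \<psi> x = edge_deriv \<psi> 0
      + (LBINT t:{0..x}. of_real (c * w t) * a - of_real (k\<^sup>2) * \<psi> t)"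
    and w: "\<forall>t\<ge>0. w t = h t" and x: "0 \<le> x"
  shows "\<psi> x = \<psi> 0 * of_real (cos (k * x)) + edge_deriv \<psi> 0 * of_real (sin (k * x) / k)
    + of_real c * a * of_real (convolve (sin_kernel k) h x)"
proof -
  define \<eta> where "\<eta> = (\<lambda>x. \<psi> x - of_real c * a * of_real (convolve (sin_kernel k) h x))"
  define \<eta>' where "\<eta>' = (\<lambda>x. edge_deriv \<psi> x - of_real c * a * of_real (convolve (cos_kernel k) h x))"
  have d1: "(\<eta> has_vector_derivative \<eta>' x) (at x within {0..})" if "0 \<le> x" for x
    unfolding \<eta>_def \<eta>'_def
    by (intro has_vector_derivative_diff has_vector_derivative_mult_right
        has_vector_derivative_edge_deriv diff has_vector_derivative_of_real_convolve that)
  have cont: "continuous_on {0..} \<eta>"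
    using has_vector_derivative_continuous[OF d1] by (simp add: continuous_on_eq_continuous_within)
  have "continuous_on {0..} \<psi>"
    using has_vector_derivative_continuous[OF has_vector_derivative_edge_deriv[OF diff]]
    by (simp add: continuous_on_eq_continuous_within)
  then have int: "set_integrable lborel {0..x} \<psi>" for x
    by (rule borel_integrable_atLeastAtMost'[OF continuous_on_subset]) auto
  have "(\<eta>' has_vector_derivative - of_real (k\<^sup>2) * \<eta> x) (at x within {0..})" if "0 \<le> x" for x
  proof (rule has_vector_derivative_indefinite[where c = "edge_deriv \<psi> 0"])
    show "continuous_on {0..} (\<lambda>x. - of_real (k\<^sup>2) * \<eta> x)"
      by (intro continuous_intros cont)
    show "\<eta>' x = edge_deriv \<psi> 0 + (LBINT t:{0..x}. - of_real (k\<^sup>2) * \<eta> t)" if "0 \<le> x" for x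
      unfolding \<eta>'_def eq[OF that] set_integral_forcing(2)[OF int w] set_integral_mult_right \<eta>_def
      by simp
  qed fact
  from harmonic_oscillator_unique[OF k d1 this x] have
    "\<eta> x = \<eta> 0 * of_real (cos (k * x)) + \<eta>' 0 * of_real (sin (k * x) / k)" by simp
  then show ?thesis
    by (simp add: \<eta>_def \<eta>'_def convolve_kernel_0[OF k h supp] diff_eq_eq)
qed

lemma has_vector_derivative_edge_wave:
  assumes "0 \<le> x"
  shows "(edge_wave k h p q \<alpha> has_vector_derivative
    - of_real k * p * of_real (sin (k * x)) + q * of_real (cos (k * x))
    + \<alpha> * of_real (convolve (cos_kernel k) h x)) (at x within {0..})"
proof -
  have c: "((\<lambda>x. complex_of_real (cos (k * x))) has_vector_derivative of_real (- k * sin (k * x))) (at x within {0..})"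
    and s: "((\<lambda>x. complex_of_real (sin (k * x) / k)) has_vector_derivative of_real (cos (k * x))) (at x within {0..})"
    using k by (auto intro!: has_vector_derivative_of_real derivative_eq_intros
        simp flip: has_real_derivative_iff_has_vector_derivative)
  have "(edge_wave k h p q \<alpha> has_vector_derivative
    p * of_real (- k * sin (k * x)) + q * of_real (cos (k * x))
    + \<alpha> * of_real (convolve (cos_kernel k) h x)) (at x within {0..})"
    unfolding edge_wave_def[abs_def]
    by (intro has_vector_derivative_add has_vector_derivative_mult_right
        has_vector_derivative_of_real_convolve c s assms)
  then show ?thesis by (simp add: mult_ac)
qed

lemma edge_deriv_edge_wave:
  assumes "0 \<le> x"
  shows "edge_deriv (edge_wave k h p q \<alpha>) x = - of_real k * p * of_real (sin (k * x))
    + q * of_real (cos (k * x)) + \<alpha> * of_real (convolve (cos_kernel k) h x)"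
  by (rule edge_deriv_eqI[OF has_vector_derivative_edge_wave]) (use assms in auto)

lemma edge_wave_0: "edge_wave k h p q \<alpha> 0 = p" "edge_deriv (edge_wave k h p q \<alpha>) 0 = q"
  by (simp_all add: edge_deriv_edge_wave) (simp_all add: edge_wave_def convolve_kernel_0[OF k h supp])

lemma edge_wave_equation:
  fixes p q a :: complex and c :: real
  assumes w: "\<forall>t\<ge>0. w t = h t" and x: "0 \<le> x"
  defines "\<psi> \<equiv> edge_wave k h p q (of_real c * a)"
  shows "\<psi> differentiable (at x within {0..})"
    and "set_integrable lborel {0..x} (\<lambda>t. of_real (c * w t) * a - of_real (k\<^sup>2) * \<psi> t)"
    and "edge_deriv \<psi> x = edge_deriv \<psi> 0
      + (LBINT t:{0..x}. of_real (c * w t) * a - of_real (k\<^sup>2) * \<psi> t)"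
proof -
  show "\<psi> differentiable (at x within {0..})"
    unfolding \<psi>_def using has_vector_derivative_edge_wave[OF x] by (rule differentiableI_vector)
  have "continuous_on {0..} \<psi>"
    unfolding \<psi>_def using has_vector_derivative_continuous[OF has_vector_derivative_edge_wave]
    by (simp add: continuous_on_eq_continuous_within)
  then have int: "set_integrable lborel {0..x} \<psi>"
    by (rule borel_integrable_atLeastAtMost'[OF continuous_on_subset]) auto
  show "set_integrable lborel {0..x} (\<lambda>t. of_real (c * w t) * a - of_real (k\<^sup>2) * \<psi> t)"
    by (rule set_integral_forcing(1)[OF int w])
  \<comment> \<open>The homogeneous part and its derivative: their equation is classical and is
    integrated by the fundamental theorem, while the Duhamel part is covered by
    \<open>set_integral_forcing\<close>.\<close>
  define trig where "trig = (\<lambda>t. p * of_real (cos (k * t)) + q * of_real (sin (k * t) / k))"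
  define trig' where "trig' = (\<lambda>t. - of_real k * p * of_real (sin (k * t)) + q * of_real (cos (k * t)))"
  have d: "(trig' has_vector_derivative - of_real (k\<^sup>2) * trig t) (at t within {0..x})" for t
  proof -
    have c: "((\<lambda>x. complex_of_real (cos (k * x))) has_vector_derivative of_real (- k * sin (k * t))) (at t within {0..x})"
      and s: "((\<lambda>x. complex_of_real (sin (k * x))) has_vector_derivative of_real (k * cos (k * t))) (at t within {0..x})"
      by (auto intro!: has_vector_derivative_of_real derivative_eq_intros
          simp flip: has_real_derivative_iff_has_vector_derivative)
    have "(trig' has_vector_derivative - of_real k * p * of_real (k * cos (k * t)) + q * of_real (- k * sin (k * t)))
        (at t within {0..x})"
      unfolding trig'_def by (intro has_vector_derivative_add has_vector_derivative_mult_right c s)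
    moreover have "- of_real k * p * of_real (k * cos (k * t)) + q * of_real (- k * sin (k * t))
        = - of_real (k\<^sup>2) * trig t"
      using k by (simp add: trig_def field_simps power2_eq_square)
    ultimately show ?thesis by simp
  qed
  have "(LBINT t:{0..x}. - of_real (k\<^sup>2) * trig t) = trig' x - trig' 0"
    unfolding set_lebesgue_integral_def
    by (rule integral_FTC_Icc[OF x d]) (simp, auto intro!: continuous_intros simp: trig_def k[THEN less_imp_neq, THEN not_sym])
  then have F: "- of_real (k\<^sup>2) * (LBINT t:{0..x}. trig t) = trig' x - trig' 0"
    unfolding set_integral_mult_right .
  have T: "\<psi> t - of_real c * a * of_real (convolve (sin_kernel k) h t) = trig t" for t
    by (simp add: \<psi>_def edge_wave_def trig_def)
  have "(LBINT t:{0..x}. of_real (c * w t) * a - of_real (k\<^sup>2) * \<psi> t)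
      = of_real c * a * of_real (convolve (cos_kernel k) h x) + (trig' x - trig' 0)"
    unfolding set_integral_forcing(2)[OF int w] T F[symmetric] by simp
  then show "edge_deriv \<psi> x = edge_deriv \<psi> 0
      + (LBINT t:{0..x}. of_real (c * w t) * a - of_real (k\<^sup>2) * \<psi> t)"
    by (simp add: \<psi>_def edge_deriv_edge_wave x edge_wave_0 trig'_def)
qed

end

section \<open>Moments, source and response\<close>

definition cos_moment :: "real \<Rightarrow> (real \<Rightarrow> real) \<Rightarrow> real" where
  "cos_moment k h = (LBINT t. cos (k * t) * h t)"

definition sin_moment :: "real \<Rightarrow> (real \<Rightarrow> real) \<Rightarrow> real" where
  "sin_moment k h = (LBINT t. sin (k * t) * h t)"

text \<open>The double integral of \<open>h x * h t * sin (k * (x - t)) / k\<close> over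
  \<open>t \<le> x\<close>: the response to the forcing, tested against the forcing itself.\<close>

definition self_interaction :: "real \<Rightarrow> (real \<Rightarrow> real) \<Rightarrow> real" where
  "self_interaction k h = (LBINT x. convolve (sin_kernel k) h x * h x)"

lemma integrable_convolve_times:
  fixes \<kappa> h :: "real \<Rightarrow> real"
  assumes [measurable]: "\<kappa> \<in> borel_measurable borel" and b: "\<And>s. \<bar>\<kappa> s\<bar> \<le> b" and h: "integrable lborel h"
  shows "integrable lborel (\<lambda>x. convolve \<kappa> h x * h x)"
proof -
  have "(\<lambda>p. \<kappa> (fst p - snd p)) \<in> borel_measurable (lborel \<Otimes>\<^sub>M lborel)"
    by measurable
  from integrable_kernel_times_product[OF this _ h h, of b] b
  have "integrable (lborel \<Otimes>\<^sub>M lborel) (\<lambda>(x, t). \<kappa> (x - t) * (h x * h t))"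
    by simp
  from lborel_pair.integrable_fst'[OF this]
  have "integrable lborel (\<lambda>x. LBINT t. (\<kappa> (x - t) * h t) * h x)"
    by (simp add: mult_ac)
  then show ?thesis
    by (simp only: convolve_def integral_mult_left_zero)
qed

lemma edge_wave_integral:
  assumes k: "k > 0" and h: "integrable lborel h"
  shows "integrable lborel (\<lambda>x. edge_wave k h p q \<alpha> x * of_real (h x))"
    and "(LBINT x. edge_wave k h p q \<alpha> x * of_real (h x))
      = p * of_real (cos_moment k h) + q * of_real (sin_moment k h) / of_real k + \<alpha> * of_real (self_interaction k h)"
proof -
  have c: "integrable lborel (\<lambda>x. cos (k * x) * h x)" and s: "integrable lborel (\<lambda>x. sin (k * x) * h x)"
    by (rule integrable_bounded_times[OF _ _ h, of _ 1]; simp)+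
  have z: "integrable lborel (\<lambda>x. convolve (sin_kernel k) h x * h x)"
    by (rule integrable_convolve_times[OF _ sin_kernel_bound[OF k] h]) simp
  have c': "integrable lborel (\<lambda>x. p * complex_of_real (cos (k * x) * h x))"
    and s': "integrable lborel (\<lambda>x. q / of_real k * complex_of_real (sin (k * x) * h x))"
    and z': "integrable lborel (\<lambda>x. \<alpha> * complex_of_real (convolve (sin_kernel k) h x * h x))"
    by (intro integrable_mult_right integrable_of_real c s z)+
  have eq: "edge_wave k h p q \<alpha> x * of_real (h x)
      = p * complex_of_real (cos (k * x) * h x) + q / of_real k * complex_of_real (sin (k * x) * h x)
        + \<alpha> * complex_of_real (convolve (sin_kernel k) h x * h x)" for x
    by (simp add: edge_wave_def field_simps)
  show "integrable lborel (\<lambda>x. edge_wave k h p q \<alpha> x * of_real (h x))"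
    unfolding eq by (intro Bochner_Integration.integrable_add c' s' z')
  have "(LBINT x. edge_wave k h p q \<alpha> x * of_real (h x))
      = (LBINT x. p * complex_of_real (cos (k * x) * h x))
        + (LBINT x. q / of_real k * complex_of_real (sin (k * x) * h x))
        + (LBINT x. \<alpha> * complex_of_real (convolve (sin_kernel k) h x * h x))"
    unfolding eq
    by (subst Bochner_Integration.integral_add[OF Bochner_Integration.integrable_add[OF c' s'] z'],
        subst Bochner_Integration.integral_add[OF c' s']) (rule refl)
  also have "\<dots> = p * of_real (LBINT x. cos (k * x) * h x) + q / of_real k * of_real (LBINT x. sin (k * x) * h x)
        + \<alpha> * of_real (LBINT x. convolve (sin_kernel k) h x * h x)"
    by (simp only: integral_mult_right_zero integral_complex_of_real)
  finally show "(LBINT x. edge_wave k h p q \<alpha> x * of_real (h x))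
      = p * of_real (cos_moment k h) + q * of_real (sin_moment k h) / of_real k + \<alpha> * of_real (self_interaction k h)"
    by (simp add: cos_moment_def sin_moment_def self_interaction_def)
qed

lemma edge_wave_beyond_support:
  assumes k: "k > 0" and h: "integrable lborel h" and supp: "\<forall>t<0. h t = 0" "\<forall>t>b. h t = 0" and x: "b \<le> x"
  shows "edge_wave k h p q \<alpha> x = (p - \<alpha> * of_real (sin_moment k h) / of_real k) * of_real (cos (k * x))
    + (q + \<alpha> * of_real (cos_moment k h)) / of_real k * of_real (sin (k * x))"
  using k supp(2)
  by (simp add: edge_wave_def convolve_sin_kernel_beyond_support[OF k h supp(1) _ x]
      flip: cos_moment_def sin_moment_def) (simp add: field_simps)

text \<open>In terms of the edgewise cosine moments \<open>C\<close>, sine moments \<open>D\<close> and the total self-interaction \<open>W\<close>,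
  testing the scattering solution with incoming edge \<open>i\<close> against the potential gives a number \<open>a\<close> with
  \<open>a * (1 + c * response k C D W) = source C D i\<close>.\<close>

definition source :: "('n::finite \<Rightarrow> real) \<Rightarrow> ('n \<Rightarrow> real) \<Rightarrow> 'n \<Rightarrow> complex" where
  "source C D i = 2 / of_nat CARD('n) * (\<Sum>j\<in>UNIV. of_real (C j) + \<i> * of_real (D j)) - 2 * \<i> * of_real (D i)"

definition response :: "real \<Rightarrow> ('n::finite \<Rightarrow> real) \<Rightarrow> ('n \<Rightarrow> real) \<Rightarrow> real \<Rightarrow> complex" where
  "response k C D W = \<i> * (\<Sum>j\<in>UNIV. of_real (C j) + \<i> * of_real (D j))\<^sup>2 / (of_real k * of_nat CARD('n))
    + (\<Sum>j\<in>UNIV. (of_real (C j) + \<i> * of_real (D j)) * of_real (D j)) / of_real k - of_real W"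

text \<open>If the denominator is zero, division by zero drops the last term. This is the right
  value, because the sources then vanish.\<close>

definition rank_one_scat :: "real \<Rightarrow> real \<Rightarrow> ('n::finite \<Rightarrow> real) \<Rightarrow> ('n \<Rightarrow> real) \<Rightarrow> real \<Rightarrow> complex^'n^'n" where
  "rank_one_scat c k C D W = (\<chi> i j. 2 / of_nat CARD('n) - (if i = j then 1 else 0)
    - \<i> * of_real c * source C D i * source C D j / (2 * of_real k * (1 + of_real c * response k C D W)))"

lemma sum_sq_dev:
  fixes D :: "'n::finite \<Rightarrow> real"
  shows "(\<Sum>j\<in>UNIV. (D j - (\<Sum>l\<in>UNIV. D l) / CARD('n))\<^sup>2) = (\<Sum>j\<in>UNIV. (D j)\<^sup>2) - (\<Sum>l\<in>UNIV. D l)\<^sup>2 / CARD('n)"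
proof -
  define m where "m = (\<Sum>l\<in>UNIV. D l) / CARD('n)"
  have "(\<Sum>j\<in>UNIV. (D j - m)\<^sup>2) = (\<Sum>j\<in>UNIV. (D j)\<^sup>2) - 2 * m * (\<Sum>j\<in>UNIV. D j) + CARD('n) * m\<^sup>2"
    by (simp add: power2_diff sum.distrib sum_subtractf flip: sum_distrib_left sum_distrib_right)
  then show ?thesis
    by (simp add: m_def power2_eq_square)
qed

text \<open>Optical theorem: the imaginary part of the response controls the source. This bounds the
  scattering matrix uniformly and shows that a vanishing denominator forces a vanishing source.\<close>

lemma source_le_Im_response:
  fixes C D :: "'n::finite \<Rightarrow> real"
  assumes "k > 0"
  shows "(cmod (source C D i))\<^sup>2 \<le> 4 * k * Im (response k C D W)"
proof -
  define n where "n = real CARD('n)"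
  have n: "n \<ge> 1" unfolding n_def by (simp add: Suc_leI)
  define c where "c = (\<Sum>j\<in>UNIV. C j)"
  define d where "d = (\<Sum>j\<in>UNIV. D j)"
  have E: "(\<Sum>j\<in>UNIV. complex_of_real (C j) + \<i> * of_real (D j)) = of_real c + \<i> * of_real d"
    by (simp add: c_def d_def sum.distrib sum_distrib_left)
  have F: "(\<Sum>j\<in>UNIV. (complex_of_real (C j) + \<i> * of_real (D j)) * of_real (D j))
      = of_real (\<Sum>j\<in>UNIV. C j * D j) + \<i> * of_real (\<Sum>j\<in>UNIV. (D j)\<^sup>2)"
    by (simp add: sum_distrib_left distrib_right power2_eq_square mult.assoc flip: sum.distrib)
  have nn: "of_nat CARD('n) = complex_of_real n" by (simp add: n_def)
  have S: "source C D i = of_real (2 * c / n) + \<i> * of_real (2 * (d / n - D i))"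
    unfolding source_def E nn by (simp add: algebra_simps)
  have "(cmod (source C D i))\<^sup>2 = 4 * (c\<^sup>2 / n / n + (d / n - D i)\<^sup>2)"
    unfolding S cmod_power2 by (simp add: power2_eq_square algebra_simps)
  also have "\<dots> \<le> 4 * (c\<^sup>2 / n + (\<Sum>j\<in>UNIV. (D j - d / n)\<^sup>2))"
  proof -
    \<comment> \<open>Two losses: one factor 1/n is discarded, and the single deviation of edge
      \<open>i\<close> is bounded by the sum over all edges.\<close>
    have "c\<^sup>2 / n / n \<le> c\<^sup>2 / n"
      using n divide_left_mono[of 1 n "c\<^sup>2 / n"] by simp
    moreover have "(D i - d / n)\<^sup>2 \<le> (\<Sum>j\<in>UNIV. (D j - d / n)\<^sup>2)"
      by (rule member_le_sum) auto
    ultimately show ?thesis by (simp add: power2_commute)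
  qed
  also have "\<dots> = 4 * (c\<^sup>2 / n + ((\<Sum>j\<in>UNIV. (D j)\<^sup>2) - d\<^sup>2 / n))"
    using sum_sq_dev[of D] by (simp add: n_def d_def)
  also have "\<dots> = 4 * k * Im (response k C D W)"
  proof -
    \<comment> \<open>\<open>W\<close> and the products \<open>C j * D j\<close> are real and drop
      out of the imaginary part. What remains is c^2/n plus the sum of squared deviations of
      \<open>D\<close>, divided by \<open>k\<close>.\<close>
    have "response k C D W = (\<i> * (of_real c + \<i> * of_real d)\<^sup>2) / of_real (k * n)
      + (of_real (\<Sum>j\<in>UNIV. C j * D j) + \<i> * of_real (\<Sum>j\<in>UNIV. (D j)\<^sup>2)) / of_real k - of_real W"
      unfolding response_def E F nn by simp
    then have "Im (response k C D W) = (c\<^sup>2 - d\<^sup>2) / (k * n) + (\<Sum>j\<in>UNIV. (D j)\<^sup>2) / k"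
      by (simp only: Im_divide_of_real minus_complex.sel plus_complex.sel times_complex.sel imaginary_unit.sel
          Re_complex_of_real Im_complex_of_real power2_eq_square) simp
    then show ?thesis
      using \<open>k > 0\<close> n by (simp add: field_simps)
  qed
  finally show ?thesis .
qed

text \<open>For real \<open>c\<close> the imaginary part of the denominator X is
  \<open>c * Im M\<close>, so |c| Im M \<le> |X|, while a product of two sources is at most 4 k Im
  M. The rank-one term is thus at most 2 for every \<open>c\<close>, and 5 = 2 + 1 + 2 collects
  \<open>2 / n\<close>, the Kronecker delta and this term.\<close>

lemma rank_one_scat_bound:
  fixes C D :: "'n::finite \<Rightarrow> real"
  assumes k: "k > 0"
  shows "1 + of_real c * response k C D W = 0 \<Longrightarrow> source C D i = 0"
    and "cmod (rank_one_scat c k C D W $ i $ j) \<le> 5"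
proof -
  define M where "M = response k C D W"
  define X where "X = 1 + of_real c * M"
  have src: "cmod (source C D i) \<le> sqrt (4 * k * Im M)" for i
    using real_le_rsqrt[OF source_le_Im_response[OF k, of C D i W]] by (simp add: M_def)
  have Im: "0 \<le> 4 * k * Im M"
    using order_trans[OF zero_le_power2 source_le_Im_response[OF k, of C D i W]] by (simp add: M_def)
  have ImX: "\<bar>c\<bar> * Im M \<le> cmod X"
    using abs_Im_le_cmod[of X] Im k by (simp add: X_def abs_mult zero_le_mult_iff)
  show "source C D i = 0" if "1 + of_real c * response k C D W = 0"
  proof -
    have "X = 0" using that by (simp add: X_def M_def)
    moreover from this have "c \<noteq> 0" by (auto simp: X_def)
    ultimately have "Im M \<le> 0" using ImX by (simp add: mult_le_0_iff)
    then have "sqrt (4 * k * Im M) \<le> 0"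
      using k by (simp add: mult_le_0_iff)
    with src[of i] show ?thesis
      by (meson norm_le_zero_iff order_trans)
  qed
  have "cmod (source C D i) * cmod (source C D j) \<le> sqrt (4 * k * Im M) * sqrt (4 * k * Im M)"
    by (intro mult_mono src) (use Im in auto)
  also have "\<dots> = 4 * k * Im M" using Im by simp
  finally have prod: "cmod (source C D i) * cmod (source C D j) \<le> 4 * k * Im M" .
  have "cmod (\<i> * of_real c * source C D i * source C D j / (2 * of_real k * X)) \<le> 2"
  proof (cases "X = 0")
    case False
    have "cmod (\<i> * of_real c * source C D i * source C D j) \<le> \<bar>c\<bar> * (4 * k * Im M)"
      using mult_left_mono[OF prod abs_ge_zero[of c]] by (simp add: norm_mult mult.assoc)
    also have "\<dots> \<le> 2 * (2 * k * cmod X)"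
      using mult_left_mono[OF ImX, of "4 * k"] k by (simp add: mult_ac)
    finally show ?thesis
      using False k by (simp add: norm_divide norm_mult divide_le_eq)
  qed simp
  moreover have "cmod (2 / of_nat CARD('n)) \<le> 2"
  proof -
    have "1 \<le> real CARD('n)" by (simp add: Suc_leI)
    then show ?thesis by (simp add: norm_divide divide_le_eq)
  qed
  ultimately have "cmod (2 / of_nat CARD('n) - (if i = j then 1 else 0)
      - \<i> * of_real c * source C D i * source C D j / (2 * of_real k * X)) \<le> 2 + 1 + 2"
    by (intro norm_triangle_le_diff[OF add_mono] norm_triangle_le_diff[OF add_mono]) auto
  then show "cmod (rank_one_scat c k C D W $ i $ j) \<le> 5"
    by (simp add: rank_one_scat_def X_def M_def)
qed

section \<open>The scattering matrix at positive scale\<close>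

text \<open>Two sample points beyond 1 suffice: one where k x is a multiple of 2 pi, which isolates
  the cosine coefficient, and one a quarter period later, which isolates the sine
  coefficient.\<close>

lemma wave_coefficients_unique:
  fixes a b a' b' :: complex
  assumes k: "k > 0"
    and eq: "\<And>x. 1 \<le> x \<Longrightarrow> a * of_real (cos (k * x)) + b * of_real (sin (k * x))
      = a' * of_real (cos (k * x)) + b' * of_real (sin (k * x))"
  shows "a = a' \<and> b = b'"
proof -
  obtain m :: nat where m: "k \<le> real m"
    using real_arch_simple by blast
  define x where "x = 2 * pi * real m / k"
  have "k \<le> 2 * pi * real m"
    using m mult_mono[of 1 "2 * pi" k "real m"] pi_gt3 k by simp
  then have "1 \<le> x" using k by (simp add: x_def)
  then have x: "1 \<le> x" "1 \<le> x + pi / 2 / k"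
    using k by (auto intro: add_increasing2)
  have kx: "k * x = 2 * pi * real m" "k * (x + pi / 2 / k) = 2 * pi * real m + pi / 2"
    using k by (simp_all add: x_def field_simps)
  have "cos (2 * pi * real m) = 1" "sin (2 * pi * real m) = 0"
    using cos_2npi[of m] sin_2npi[of m] by (simp_all add: mult_ac)
  with eq[OF x(1)] eq[OF x(2)] show ?thesis
    unfolding kx by (simp add: cos_add sin_add)
qed

lemma incoming_outgoing_wave:
  fixes \<delta> s :: complex
  shows "\<delta> * exp (- \<i> * complex_of_real k * complex_of_real x) + s * exp (\<i> * complex_of_real k * complex_of_real x)
    = (\<delta> + s) * of_real (cos (k * x)) + \<i> * (s - \<delta>) * of_real (sin (k * x))"
proof -
  have "exp (\<i> * complex_of_real k * complex_of_real x) = of_real (cos (k * x)) + \<i> * of_real (sin (k * x))"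
    using exp_Euler[of "of_real (k * x)"] by (simp add: mult.assoc flip: cos_of_real sin_of_real)
  moreover have "exp (- \<i> * complex_of_real k * complex_of_real x) = of_real (cos (k * x)) - \<i> * of_real (sin (k * x))"
    using exp_Euler[of "of_real (- (k * x))"] by (simp add: mult.assoc flip: cos_of_real sin_of_real)
  ultimately show ?thesis
    by (simp only:) (simp add: algebra_simps)
qed

text \<open>Here \<open>\<alpha> = c * a\<close> is the forcing strength, \<open>P\<close> the common vertex value and \<open>Q j\<close> the vertex derivatives.\<close>

lemma scattering_system_solution:
  fixes C D W :: "'n::finite \<Rightarrow> real" and s Q :: "'n \<Rightarrow> complex" and P a :: complex
  assumes k: "k > 0"
    and cos_eq: "\<And>j. P - of_real c * a * of_real (D j) / of_real k = (if j = i then 1 else 0) + s j"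
    and sin_eq: "\<And>j. (Q j + of_real c * a * of_real (C j)) / of_real k = \<i> * (s j - (if j = i then 1 else 0))"
    and kirchhoff: "(\<Sum>j\<in>UNIV. Q j) = 0"
    and a: "a = (\<Sum>j\<in>UNIV. P * of_real (C j) + Q j * of_real (D j) / of_real k + of_real c * a * of_real (W j))"
  shows "s j = rank_one_scat c k C D (\<Sum>j\<in>UNIV. W j) $ i $ j"
proof -
  define n where "n = complex_of_nat CARD('n)"
  have n: "n \<noteq> 0" by (simp add: n_def)
  define \<delta> where "\<delta> = (\<lambda>j. if j = i then 1 else 0 :: complex)"
  have \<delta>: "(\<Sum>j\<in>UNIV. \<delta> j) = 1" "(\<Sum>j\<in>UNIV. \<delta> j * f j) = f i" "(if j = i then 1 else 0) = \<delta> j" for f j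
    by (simp_all add: \<delta>_def if_distrib[of "\<lambda>x. x * _"] cong: if_cong)
  define \<kappa> where "\<kappa> = complex_of_real k"
  have \<kappa>: "\<kappa> \<noteq> 0" using k by (simp add: \<kappa>_def)
  define \<alpha> where "\<alpha> = of_real c * a"
  define e where "e = (\<lambda>j. complex_of_real (C j) + \<i> * of_real (D j))"
  define E where "E = (\<Sum>j\<in>UNIV. e j)"
  define G where "G = (\<Sum>j\<in>UNIV. e j * of_real (D j))"
  define w where "w = complex_of_real (\<Sum>j\<in>UNIV. W j)"
  have s: "s j = P - \<alpha> * of_real (D j) / \<kappa> - \<delta> j" for j
    using cos_eq[of j] unfolding \<delta>_def \<alpha>_def \<kappa>_def by (metis add_diff_cancel_left')
  have Q: "Q j = \<i> * \<kappa> * P - 2 * \<i> * \<kappa> * \<delta> j - \<alpha> * e j" for j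
  proof -
    have "Q j + \<alpha> * of_real (C j) = \<kappa> * (\<i> * (s j - \<delta> j))"
      using sin_eq[of j] \<kappa> unfolding \<delta>_def \<alpha>_def \<kappa>_def by (metis nonzero_divide_eq_eq mult.commute)
    then show ?thesis
      using \<kappa> unfolding s e_def by (simp add: algebra_simps)
  qed
  \<comment> \<open>Kirchhoff's condition fixes the vertex value in terms of
    \<open>\<alpha>\<close>. Since \<open>s\<close> and \<open>Q\<close> are already expressed
    through both, \<open>\<alpha>\<close> is the only unknown left.\<close>
  have sumQ: "\<i> * \<kappa> * (n * P - 2) = \<alpha> * E"
    using kirchhoff unfolding Q sum_subtractf sum_distrib_left[symmetric] \<delta>
    by (simp add: E_def n_def algebra_simps flip: sum_distrib_left)
  have P: "P = 2 / n - \<i> * \<alpha> * E / (\<kappa> * n)"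
  proof -
    have "\<i> * \<alpha> * E = - (\<kappa> * (n * P - 2))"
      by (simp add: mult.assoc flip: sumQ)
    then have "2 / n - \<i> * \<alpha> * E / (\<kappa> * n) = 2 / n + (n * P - 2) / n"
      using \<kappa> by simp
    then show ?thesis using n by (simp add: diff_divide_distrib)
  qed
  have src: "source C D j = 2 / n * E - 2 * \<i> * of_real (D j)" for j
    by (simp add: source_def n_def E_def e_def)
  have resp: "response k C D (\<Sum>j\<in>UNIV. W j) = \<i> * E\<^sup>2 / (\<kappa> * n) + G / \<kappa> - w"
    by (simp add: response_def n_def E_def e_def G_def \<kappa>_def w_def)
  \<comment> \<open>Inserting \<open>Q\<close> joins the sine contribution
    \<open>\<i> * P * D j\<close> to the cosine contribution \<open>P * C j\<close>, which is why
    the combination \<open>e j\<close> appears.\<close>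
  have "a = (\<Sum>j\<in>UNIV. P * e j - 2 * \<i> * (\<delta> j * of_real (D j))
      - \<alpha> * (e j * of_real (D j) / \<kappa>) + \<alpha> * of_real (W j))"
    by (subst a, rule sum.cong[OF refl], unfold Q e_def) (use \<kappa> in \<open>simp add: field_simps \<alpha>_def \<kappa>_def\<close>)
  also have "\<dots> = P * E - 2 * \<i> * of_real (D i) - \<alpha> * (G / \<kappa>) + \<alpha> * w"
    unfolding sum.distrib sum_subtractf sum_distrib_left[symmetric] sum_divide_distrib[symmetric] \<delta>
    by (simp add: E_def G_def w_def)
  also have "\<dots> = source C D i - \<alpha> * response k C D (\<Sum>j\<in>UNIV. W j)"
    unfolding P src resp using n \<kappa> by (simp add: field_simps power2_eq_square)
  finally have main: "a * (1 + of_real c * response k C D (\<Sum>j\<in>UNIV. W j)) = source C D i"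
    by (simp add: \<alpha>_def algebra_simps)
  have sj: "s j = 2 / n - \<delta> j - \<i> * \<alpha> * source C D j / (2 * \<kappa>)"
    unfolding s src P using n \<kappa> by (simp add: field_simps)
  show ?thesis
  \<comment> \<open>In the degenerate case \<open>main\<close> leaves \<open>a\<close> free, but in
    \<open>sj\<close> it is multiplied by \<open>source C D j\<close>, which is zero.\<close>
  proof (cases "1 + of_real c * response k C D (\<Sum>j\<in>UNIV. W j) = 0")
    case True
    from rank_one_scat_bound(1)[OF k True] show ?thesis
      by (simp add: sj rank_one_scat_def n_def \<delta>_def eq_commute[of j])
  next
    case False
    then have "a = source C D i / (1 + of_real c * response k C D (\<Sum>j\<in>UNIV. W j))"
      using main by (simp add: eq_divide_eq)
    then show ?thesis
      by (simp add: sj rank_one_scat_def n_def \<delta>_def eq_commute[of j] \<alpha>_def \<kappa>_def mult_ac)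
  qed
qed

text \<open>The elimination of the uniqueness proof read backwards: \<open>a\<close> is chosen
  first, then \<open>P\<close> from Kirchhoff's condition and \<open>Q\<close> from matching. The
  equation for \<open>a\<close> is the only one left to close.\<close>

lemma scattering_system_exists:
  fixes C D W :: "'n::finite \<Rightarrow> real"
  assumes k: "k > 0"
  obtains P a :: complex and Q :: "'n \<Rightarrow> complex" where
    "\<And>j. P - of_real c * a * of_real (D j) / of_real k
      = (if j = i then 1 else 0) + rank_one_scat c k C D (\<Sum>j\<in>UNIV. W j) $ i $ j"
    "\<And>j. (Q j + of_real c * a * of_real (C j)) / of_real k
      = \<i> * (rank_one_scat c k C D (\<Sum>j\<in>UNIV. W j) $ i $ j - (if j = i then 1 else 0))"
    "(\<Sum>j\<in>UNIV. Q j) = 0"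
    "a = (\<Sum>j\<in>UNIV. P * of_real (C j) + Q j * of_real (D j) / of_real k + of_real c * a * of_real (W j))"
proof
  define n where "n = complex_of_nat CARD('n)"
  have n: "n \<noteq> 0" by (simp add: n_def)
  define \<delta> where "\<delta> = (\<lambda>j. if j = i then 1 else 0 :: complex)"
  have \<delta>: "(\<Sum>j\<in>UNIV. \<delta> j) = 1" "(\<Sum>j\<in>UNIV. \<delta> j * f j) = f i" "(if j = i then 1 else 0) = \<delta> j" for f j
    by (simp_all add: \<delta>_def if_distrib[of "\<lambda>x. x * _"] cong: if_cong)
  define \<kappa> where "\<kappa> = complex_of_real k"
  have \<kappa>: "\<kappa> \<noteq> 0" using k by (simp add: \<kappa>_def)
  define X where "X = 1 + of_real c * response k C D (\<Sum>j\<in>UNIV. W j)"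
  \<comment> \<open>For \<open>X = 0\<close> this is 0, a legitimate choice among the then arbitrary
    amplitudes.\<close>
  define a where "a = source C D i / X"
  define \<alpha> where "\<alpha> = of_real c * a"
  define e where "e = (\<lambda>j. complex_of_real (C j) + \<i> * of_real (D j))"
  define E where "E = (\<Sum>j\<in>UNIV. e j)"
  define G where "G = (\<Sum>j\<in>UNIV. e j * of_real (D j))"
  define w where "w = complex_of_real (\<Sum>j\<in>UNIV. W j)"
  define P where "P = 2 / n - \<i> * \<alpha> * E / (\<kappa> * n)"
  define Q where "Q = (\<lambda>j. \<i> * \<kappa> * P - 2 * \<i> * \<kappa> * \<delta> j - \<alpha> * e j)"
  have src: "source C D j = 2 / n * E - 2 * \<i> * of_real (D j)" for j
    by (simp add: source_def n_def E_def e_def)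
  have resp: "response k C D (\<Sum>j\<in>UNIV. W j) = \<i> * E\<^sup>2 / (\<kappa> * n) + G / \<kappa> - w"
    by (simp add: response_def n_def E_def e_def G_def \<kappa>_def w_def)
  have rows: "rank_one_scat c k C D (\<Sum>j\<in>UNIV. W j) $ i $ j
      = 2 / n - \<delta> j - \<i> * \<alpha> * source C D j / (2 * \<kappa>)" for j
    by (simp add: rank_one_scat_def n_def \<alpha>_def a_def X_def \<kappa>_def \<delta>_def mult_ac eq_commute[of j])
  show "P - of_real c * a * of_real (D j) / of_real k
      = (if j = i then 1 else 0) + rank_one_scat c k C D (\<Sum>j\<in>UNIV. W j) $ i $ j" for j
    unfolding rows src P_def \<delta> \<alpha>_def[symmetric] \<kappa>_def[symmetric] using n \<kappa> by (simp add: field_simps)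
  show "(Q j + of_real c * a * of_real (C j)) / of_real k
      = \<i> * (rank_one_scat c k C D (\<Sum>j\<in>UNIV. W j) $ i $ j - (if j = i then 1 else 0))" for j
    unfolding rows src P_def \<delta> Q_def e_def \<alpha>_def[symmetric] \<kappa>_def[symmetric] using n \<kappa> by (simp add: field_simps)
  have "(\<Sum>j\<in>UNIV. Q j) = \<i> * \<kappa> * (n * P - 2) - \<alpha> * E"
    unfolding Q_def sum_subtractf sum_distrib_left[symmetric] \<delta>
    by (simp add: E_def n_def algebra_simps)
  also have "\<dots> = 0"
    unfolding P_def using n \<kappa> by (simp add: field_simps)
  finally show "(\<Sum>j\<in>UNIV. Q j) = 0" .
  have "(\<Sum>j\<in>UNIV. P * of_real (C j) + Q j * of_real (D j) / \<kappa> + \<alpha> * of_real (W j))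
    = (\<Sum>j\<in>UNIV. P * e j - 2 * \<i> * (\<delta> j * of_real (D j))
      - \<alpha> * (e j * of_real (D j) / \<kappa>) + \<alpha> * of_real (W j))"
    by (rule sum.cong[OF refl], unfold Q_def e_def) (use \<kappa> in \<open>simp add: field_simps\<close>)
  also have "\<dots> = P * E - 2 * \<i> * of_real (D i) - \<alpha> * (G / \<kappa>) + \<alpha> * w"
    unfolding sum.distrib sum_subtractf sum_distrib_left[symmetric] sum_divide_distrib[symmetric] \<delta>
    by (simp add: E_def G_def w_def)
  also have "\<dots> = source C D i - \<alpha> * response k C D (\<Sum>j\<in>UNIV. W j)"
    unfolding P_def src resp using n \<kappa> by (simp add: field_simps power2_eq_square)
  also have "\<dots> = source C D i - a * (X - 1)"
    by (simp add: \<alpha>_def X_def)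
  \<comment> \<open>For \<open>X = 0\<close> both \<open>a\<close> and the source are 0; otherwise
    this is the definition of \<open>a\<close>.\<close>
  also have "\<dots> = a"
    using rank_one_scat_bound(1)[OF k, of c C D "\<Sum>j\<in>UNIV. W j" i]
    by (cases "X = 0") (simp_all add: a_def X_def[symmetric] field_simps)
  finally show "a = (\<Sum>j\<in>UNIV. P * of_real (C j) + Q j * of_real (D j) / of_real k + of_real c * a * of_real (W j))"
    by (simp add: \<alpha>_def \<kappa>_def)
qed

section \<open>From waves on the graph to the finite linear system\<close>

context
  fixes V :: "'n::finite \<Rightarrow> real \<Rightarrow> real" and eps k :: real and h :: "'n \<Rightarrow> real \<Rightarrow> real"
  assumes k: "k > 0" and h: "\<And>j. integrable lborel (h j)"
    and supp: "\<And>j. \<forall>t<0. h j t = 0" "\<And>j. \<forall>t>1. h j t = 0"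
    and V: "\<And>j. \<forall>t\<ge>0. V j (t / eps) = h j t"
begin

abbreviation (input) scat_eps :: "real \<Rightarrow> complex^'n^'n" where
  "scat_eps c \<equiv> rank_one_scat c k (\<lambda>j. cos_moment k (h j)) (\<lambda>j. sin_moment k (h j))
    (\<Sum>j\<in>UNIV. self_interaction k (h j))"

lemma graph_inner_edge_wave:
  assumes "\<And>x. 0 \<le> x \<Longrightarrow> \<psi> x = edge_wave k (h j) p q \<alpha> x"
  shows "set_integrable lborel {0..} (\<lambda>x. \<psi> x * of_real (V j (x / eps)))"
    and "(LBINT x:{0..}. \<psi> x * of_real (V j (x / eps))) = p * of_real (cos_moment k (h j))
      + q * of_real (sin_moment k (h j)) / of_real k + \<alpha> * of_real (self_interaction k (h j))"
proof -
  have eq: "(\<lambda>x. indicator {0..} x *\<^sub>R (\<psi> x * of_real (V j (x / eps))))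
      = (\<lambda>x. edge_wave k (h j) p q \<alpha> x * of_real (h j x))"
    using assms V[of j] supp(1)[of j] by (auto simp: indicator_def)
  show "set_integrable lborel {0..} (\<lambda>x. \<psi> x * of_real (V j (x / eps)))"
    unfolding set_integrable_def eq by (rule edge_wave_integral(1)[OF k h])
  show "(LBINT x:{0..}. \<psi> x * of_real (V j (x / eps))) = p * of_real (cos_moment k (h j))
      + q * of_real (sin_moment k (h j)) / of_real k + \<alpha> * of_real (self_interaction k (h j))"
    unfolding set_lebesgue_integral_def eq by (rule edge_wave_integral(2)[OF k h])
qed

lemma eps_scat_solution_row:
  assumes "is_eps_scat_solution V c eps k i \<psi> s"
  shows "s = scat_eps c $ i"
proof -
  define a where "a = graph_inner \<psi> (\<lambda>j x. V j (x / eps))"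
  from assms have diff: "\<And>j x. 0 \<le> x \<Longrightarrow> \<psi> j differentiable (at x within {0..})"
    and eq: "\<And>j x. 0 \<le> x \<Longrightarrow> edge_deriv (\<psi> j) x = edge_deriv (\<psi> j) 0
       + (LBINT t:{0..x}. of_real (c * V j (t / eps)) * a - of_real (k\<^sup>2) * \<psi> j t)"
    and vertex: "\<And>j. \<psi> j 0 = \<psi> i 0" and kirchhoff: "(\<Sum>j\<in>UNIV. edge_deriv (\<psi> j) 0) = 0"
    and outer: "\<And>j x. 1 \<le> x \<Longrightarrow> \<psi> j x = (if j = i then exp (- \<i> * k * x) else 0) + s $ j * exp (\<i> * k * x)"
    unfolding is_eps_scat_solution_def Let_def a_def[symmetric] by blast+
  have wave: "\<psi> j x = edge_wave k (h j) (\<psi> i 0) (edge_deriv (\<psi> j) 0) (of_real c * a) x" if "0 \<le> x" for j x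
    using edge_equation_unique[OF k h supp(1) diff eq V that, of j] vertex[of j] by (simp add: edge_wave_def)
  \<comment> \<open>Since \<open>h\<close> is supported in [0,1], the edge wave is a free wave from
    1 on, exactly where the incoming and outgoing form is prescribed.\<close>
  have coeffs: "\<psi> i 0 - of_real c * a * of_real (sin_moment k (h j)) / of_real k = (if j = i then 1 else 0) + s $ j \<and>
     (edge_deriv (\<psi> j) 0 + of_real c * a * of_real (cos_moment k (h j))) / of_real k
        = \<i> * (s $ j - (if j = i then 1 else 0))" for j
  proof (rule wave_coefficients_unique[OF k])
    fix x :: real assume x: "1 \<le> x"
    have "((if j = i then 1 else 0) + s $ j) * of_real (cos (k * x))
        + \<i> * (s $ j - (if j = i then 1 else 0)) * of_real (sin (k * x)) = \<psi> j x"
      unfolding incoming_outgoing_wave[symmetric] outer[OF x] by simp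
    also have "\<dots> = edge_wave k (h j) (\<psi> i 0) (edge_deriv (\<psi> j) 0) (of_real c * a) x"
      using x by (intro wave) simp
    finally show "(\<psi> i 0 - of_real c * a * of_real (sin_moment k (h j)) / of_real k) * of_real (cos (k * x))
        + (edge_deriv (\<psi> j) 0 + of_real c * a * of_real (cos_moment k (h j))) / of_real k * of_real (sin (k * x))
      = ((if j = i then 1 else 0) + s $ j) * of_real (cos (k * x))
        + \<i> * (s $ j - (if j = i then 1 else 0)) * of_real (sin (k * x))"
      by (simp only: edge_wave_beyond_support[OF k h supp x])
  qed
  have "a = (\<Sum>j\<in>UNIV. \<psi> i 0 * of_real (cos_moment k (h j))
    + edge_deriv (\<psi> j) 0 * of_real (sin_moment k (h j)) / of_real k
    + of_real c * a * of_real (self_interaction k (h j)))"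
    by (subst a_def, unfold graph_inner_def) (intro sum.cong refl graph_inner_edge_wave(2) wave)
  from scattering_system_solution[OF k conjunct1[OF coeffs] conjunct2[OF coeffs] kirchhoff this]
  show ?thesis by (simp add: vec_eq_iff)
qed

lemma eps_scat_solution_exists: "\<exists>\<psi>. is_eps_scat_solution V c eps k i \<psi> (scat_eps c $ i)"
proof -
  obtain P a Q where
    cos_eq: "\<And>j. P - of_real c * a * of_real (sin_moment k (h j)) / of_real k
      = (if j = i then 1 else 0) + scat_eps c $ i $ j"
    and sin_eq: "\<And>j. (Q j + of_real c * a * of_real (cos_moment k (h j))) / of_real k
      = \<i> * (scat_eps c $ i $ j - (if j = i then 1 else 0))"
    and kirchhoff: "(\<Sum>j\<in>UNIV. Q j) = 0"
    and a: "a = (\<Sum>j\<in>UNIV. P * of_real (cos_moment k (h j)) + Q j * of_real (sin_moment k (h j)) / of_real k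
      + of_real c * a * of_real (self_interaction k (h j)))"
    by (rule scattering_system_exists[OF k, where c = c and i = i and C = "\<lambda>j. cos_moment k (h j)"
          and D = "\<lambda>j. sin_moment k (h j)" and W = "\<lambda>j. self_interaction k (h j)"]) (rule that)
  define \<psi> where "\<psi> = (\<lambda>j. edge_wave k (h j) P (Q j) (of_real c * a))"
  \<comment> \<open>Self-consistency: pairing the constructed wave with the potential must return
    the number \<open>a\<close> already built into its forcing.\<close>
  have inner: "graph_inner \<psi> (\<lambda>j x. V j (x / eps)) = a"
    unfolding graph_inner_def
    by (rule trans[OF _ a[symmetric]]) (intro sum.cong refl graph_inner_edge_wave(2), simp add: \<psi>_def)
  have outer: "\<psi> j x = (if j = i then exp (- \<i> * k * x) else 0) + scat_eps c $ i $ j * exp (\<i> * k * x)"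
    if "1 \<le> x" for j x
  proof -
    have "\<psi> j x = ((if j = i then 1 else 0) + scat_eps c $ i $ j) * of_real (cos (k * x))
        + \<i> * (scat_eps c $ i $ j - (if j = i then 1 else 0)) * of_real (sin (k * x))"
      unfolding \<psi>_def edge_wave_beyond_support[OF k h supp that] cos_eq sin_eq ..
    then show ?thesis
      unfolding incoming_outgoing_wave[symmetric] by simp
  qed
  have "is_eps_scat_solution V c eps k i \<psi> (scat_eps c $ i)"
    unfolding is_eps_scat_solution_def Let_def inner
  proof (intro conjI allI impI)
    fix j and x :: real
    show "set_integrable lborel {0..} (\<lambda>x. \<psi> j x * of_real (V j (x / eps)))"
      by (rule graph_inner_edge_wave(1)) (simp add: \<psi>_def)
    assume x: "0 \<le> x"
    show "\<psi> j differentiable (at x within {0..})"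
      unfolding \<psi>_def by (rule edge_wave_equation(1)[OF k h supp(1) V x])
    show "set_integrable lborel {0..x} (\<lambda>t. of_real (c * V j (t / eps)) * a - of_real (k\<^sup>2) * \<psi> j t)"
      unfolding \<psi>_def by (rule edge_wave_equation(2)[OF k h supp(1) V x])
    show "edge_deriv (\<psi> j) x = edge_deriv (\<psi> j) 0
        + (LBINT t:{0..x}. of_real (c * V j (t / eps)) * a - of_real (k\<^sup>2) * \<psi> j t)"
      unfolding \<psi>_def by (rule edge_wave_equation(3)[OF k h supp(1) V x])
  next
    show "\<psi> j 0 = \<psi> l 0" for j l
      by (simp add: \<psi>_def edge_wave_0[OF k h supp(1)])
    show "(\<Sum>j\<in>UNIV. edge_deriv (\<psi> j) 0) = 0"
      by (simp add: \<psi>_def edge_wave_0[OF k h supp(1)] kirchhoff)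
  qed (use outer in blast)
  then show ?thesis by blast
qed

text \<open>The definition asks only for some wave per row; since the outgoing amplitudes are the
  same for every such wave, it pins down one matrix.\<close>

lemma is_eps_scat_matrix_iff: "is_eps_scat_matrix V c eps k S \<longleftrightarrow> S = scat_eps c"
  using eps_scat_solution_row eps_scat_solution_exists
  unfolding is_eps_scat_matrix_def vec_eq_iff[of S "scat_eps c"] by metis

end

section \<open>Small-scale asymptotics of the moments\<close>

lemma integral_rescale:
  fixes f :: "real \<Rightarrow> real"
  assumes "e > 0"
  shows "(LBINT t. f t) = e * (LBINT t. f (e * t))"
  using lborel_integral_real_affine[of e f 0] assms by simp

text \<open>Each integration contributes one factor \<open>e\<close>, and
  \<open>sin_kernel k (e * s) = e * sin_kernel (k * e) s\<close> supplies the third factor in the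
  self-interaction.\<close>

lemma moments_rescale:
  fixes g :: "real \<Rightarrow> real"
  assumes e: "e > 0" and k: "k > 0"
  shows "cos_moment k (\<lambda>t. g (t / e)) = e * cos_moment (k * e) g"
    and "sin_moment k (\<lambda>t. g (t / e)) = e * sin_moment (k * e) g"
    and "self_interaction k (\<lambda>t. g (t / e)) = e ^ 3 * self_interaction (k * e) g"
proof -
  show "cos_moment k (\<lambda>t. g (t / e)) = e * cos_moment (k * e) g"
    "sin_moment k (\<lambda>t. g (t / e)) = e * sin_moment (k * e) g"
    unfolding cos_moment_def sin_moment_def
    by (subst integral_rescale[OF e], use e in \<open>simp add: mult.assoc\<close>)+
  have conv: "convolve (sin_kernel k) (\<lambda>t. g (t / e)) (e * x) = e\<^sup>2 * convolve (sin_kernel (k * e)) g x" for x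
  proof -
    have ker: "sin_kernel k (e * x - e * t) = e * sin_kernel (k * e) (x - t)" for t
      using e k by (simp add: sin_kernel_def right_diff_distrib mult_ac)
    have "convolve (sin_kernel k) (\<lambda>t. g (t / e)) (e * x) = e * (LBINT t. sin_kernel k (e * x - e * t) * g t)"
      unfolding convolve_def by (subst integral_rescale[OF e]) (use e in simp)
    also have "\<dots> = e * (LBINT t. e * (sin_kernel (k * e) (x - t) * g t))"
      by (simp only: ker mult.assoc)
    finally show ?thesis by (simp add: convolve_def power2_eq_square)
  qed
  have "self_interaction k (\<lambda>t. g (t / e)) = e * (LBINT x. e\<^sup>2 * (convolve (sin_kernel (k * e)) g x * g x))"
    unfolding self_interaction_def
    by (subst integral_rescale[OF e]) (use e in \<open>simp add: conv mult.assoc\<close>)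
  then show "self_interaction k (\<lambda>t. g (t / e)) = e ^ 3 * self_interaction (k * e) g"
    by (simp add: self_interaction_def power_numeral_reduce)
qed

lemma sin_minus_id_bound: "\<bar>sin x - x\<bar> \<le> \<bar>x\<bar> ^ 3 / 6" for x :: real
  using Maclaurin_sin_bound[of x 3] by (simp add: numeral_eq_Suc sin_coeff_def fact_numeral)

lemma one_minus_cos_bound: "\<bar>cos x - 1\<bar> \<le> x\<^sup>2 / 2" for x :: real
proof -
  have "\<bar>sin (x / 2)\<bar>\<^sup>2 \<le> \<bar>x / 2\<bar>\<^sup>2"
    by (intro power_mono abs_sin_x_le_abs_x) auto
  moreover have "cos x = 1 - 2 * (sin (x / 2))\<^sup>2"
    using cos_double_sin[of "x / 2"] by simp
  ultimately show ?thesis by (simp add: power_divide)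
qed

text \<open>The limit of \<open>sin_kernel \<kappa>\<close> as \<kappa> tends to 0 is max(s, 0).
  Capping it at 1 makes the kernel bounded, as the Fubini lemmas require, and is invisible for
  differences of points of [0,1].\<close>

definition ramp :: "real \<Rightarrow> real" where
  "ramp s = max 0 (min s 1)"

lemma measurable_ramp [measurable]: "ramp \<in> borel_measurable borel"
  unfolding ramp_def by measurable

lemma ramp_bound: "\<bar>ramp s\<bar> \<le> 1"
  by (simp add: ramp_def)

context
  fixes g :: "real \<Rightarrow> real"
  assumes g: "integrable lborel g" and supp: "\<forall>t<0. g t = 0" "\<forall>t>1. g t = 0"
begin

lemma integrable_times_on_support:
  assumes [measurable]: "f \<in> borel_measurable borel" and bound: "\<And>t. 0 \<le> t \<Longrightarrow> t \<le> 1 \<Longrightarrow> \<bar>f t\<bar> \<le> b"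
  shows "integrable lborel (\<lambda>t. f t * g t)"
    and "\<bar>LBINT t. f t * g t\<bar> \<le> b * (LBINT t. \<bar>g t\<bar>)"
proof -
  have le: "\<bar>f t * g t\<bar> \<le> b * \<bar>g t\<bar>" for t
    using bound[of t] supp by (cases "0 \<le> t \<and> t \<le> 1") (auto simp: abs_mult mult_right_mono)
  have int: "integrable lborel (\<lambda>t. b * \<bar>g t\<bar>)"
    using g by auto
  have "0 \<le> b" using order_trans[OF abs_ge_zero bound[of 0]] by simp
  show i: "integrable lborel (\<lambda>t. f t * g t)"
  proof (rule Bochner_Integration.integrable_bound[OF int])
    show "(\<lambda>t. f t * g t) \<in> borel_measurable lborel"
      using g by measurable
    show "AE t in lborel. norm (f t * g t) \<le> norm (b * \<bar>g t\<bar>)"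
      using le \<open>0 \<le> b\<close> by (intro AE_I2) (simp add: abs_mult)
  qed
  have "\<bar>LBINT t. f t * g t\<bar> \<le> (LBINT t. \<bar>f t * g t\<bar>)"
    using integral_norm_bound[of lborel "\<lambda>t. f t * g t"] by simp
  also have "\<dots> \<le> (LBINT t. b * \<bar>g t\<bar>)"
    by (rule integral_mono[OF _ int le]) (use i in auto)
  finally show "\<bar>LBINT t. f t * g t\<bar> \<le> b * (LBINT t. \<bar>g t\<bar>)" by simp
qed

lemma cos_moment_small:
  "\<bar>cos_moment \<kappa> g - (LBINT t. g t)\<bar> \<le> \<kappa>\<^sup>2 / 2 * (LBINT t. \<bar>g t\<bar>)"
proof -
  have "integrable lborel (\<lambda>t. cos (\<kappa> * t) * g t)"
    by (rule integrable_times_on_support(1)[of _ 1]) auto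
  then have "cos_moment \<kappa> g - (LBINT t. g t) = (LBINT t. (cos (\<kappa> * t) - 1) * g t)"
    using g by (simp add: cos_moment_def left_diff_distrib)
  moreover have "\<bar>cos (\<kappa> * t) - 1\<bar> \<le> \<kappa>\<^sup>2 / 2" if "0 \<le> t" "t \<le> 1" for t
  proof -
    have "t\<^sup>2 \<le> 1" using power_mono[of t 1 2] that by simp
    then have "(\<kappa> * t)\<^sup>2 / 2 \<le> \<kappa>\<^sup>2 / 2"
      using mult_left_mono[of "t\<^sup>2" 1 "\<kappa>\<^sup>2"] by (simp add: power_mult_distrib)
    then show ?thesis using one_minus_cos_bound[of "\<kappa> * t"] by linarith
  qed
  ultimately show ?thesis
    using integrable_times_on_support(2)[of "\<lambda>t. cos (\<kappa> * t) - 1" "\<kappa>\<^sup>2 / 2"] by simp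
qed

lemma sin_moment_small:
  assumes "\<kappa> \<ge> 0"
  shows "\<bar>sin_moment \<kappa> g - \<kappa> * (LBINT t. t * g t)\<bar> \<le> \<kappa> ^ 3 / 6 * (LBINT t. \<bar>g t\<bar>)"
proof -
  have 1: "integrable lborel (\<lambda>t. sin (\<kappa> * t) * g t)"
    by (rule integrable_times_on_support(1)[of _ 1]) auto
  have 2: "integrable lborel (\<lambda>t. t * g t)"
    by (rule integrable_times_on_support(1)[of _ 1]) auto
  have "sin_moment \<kappa> g - \<kappa> * (LBINT t. t * g t) = (LBINT t. sin (\<kappa> * t) * g t - \<kappa> * (t * g t))"
    using 1 2 by (simp add: sin_moment_def)
  also have "\<dots> = (LBINT t. (sin (\<kappa> * t) - \<kappa> * t) * g t)"
    by (simp add: left_diff_distrib mult.assoc)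
  finally have eq: "sin_moment \<kappa> g - \<kappa> * (LBINT t. t * g t) = (LBINT t. (sin (\<kappa> * t) - \<kappa> * t) * g t)" .
  have "\<bar>sin (\<kappa> * t) - \<kappa> * t\<bar> \<le> \<kappa> ^ 3 / 6" if "0 \<le> t" "t \<le> 1" for t
  proof -
    have "\<bar>\<kappa> * t\<bar> ^ 3 \<le> \<kappa> ^ 3"
      using that assms by (intro power_mono) (auto simp: mult_left_le)
    then show ?thesis using sin_minus_id_bound[of "\<kappa> * t"] by linarith
  qed
  then show ?thesis
    unfolding eq by (intro integrable_times_on_support(2)) auto
qed

text \<open>On [0,1] the kernels differ by at most \<kappa>^2/6, by the cubic Taylor remainder of
  sine divided by \<kappa>, and both vanish for negative argument. Using this in the inner and then
  the outer integral gives the squared norm of \<open>g\<close>.\<close>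

lemma self_interaction_small:
  assumes \<kappa>: "\<kappa> > 0"
  shows "\<bar>self_interaction \<kappa> g - (LBINT x. convolve ramp g x * g x)\<bar> \<le> \<kappa>\<^sup>2 / 6 * (LBINT t. \<bar>g t\<bar>)\<^sup>2"
proof -
  define N where "N = (LBINT t. \<bar>g t\<bar>)"
  have N: "0 \<le> N" by (simp add: N_def)
  have int1: "integrable lborel (\<lambda>t. sin_kernel \<kappa> (x - t) * g t)" for x
    by (rule integrable_convolve[OF _ sin_kernel_bound[OF \<kappa>] g]) simp
  have int2: "integrable lborel (\<lambda>t. ramp (x - t) * g t)" for x
    by (rule integrable_convolve[OF _ ramp_bound g]) simp
  have diff: "\<bar>convolve (sin_kernel \<kappa>) g x - convolve ramp g x\<bar> \<le> \<kappa>\<^sup>2 / 6 * N" if x: "0 \<le> x" "x \<le> 1" for x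
  proof -
    have "convolve (sin_kernel \<kappa>) g x - convolve ramp g x = (LBINT t. (sin_kernel \<kappa> (x - t) - ramp (x - t)) * g t)"
      using int1 int2 by (simp add: convolve_def left_diff_distrib)
    moreover have "\<bar>\<dots>\<bar> \<le> \<kappa>\<^sup>2 / 6 * N"
      unfolding N_def
    proof (rule integrable_times_on_support(2))
      fix t :: real assume t: "0 \<le> t" "t \<le> 1"
      show "\<bar>sin_kernel \<kappa> (x - t) - ramp (x - t)\<bar> \<le> \<kappa>\<^sup>2 / 6"
      proof (cases "t \<le> x")
        case True
        define s where "s = x - t"
        have s: "0 \<le> s" "s \<le> 1" using x t True by (auto simp: s_def)
        have "\<bar>sin (\<kappa> * s) - \<kappa> * s\<bar> \<le> (\<kappa> * s) ^ 3 / 6"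
          using sin_minus_id_bound[of "\<kappa> * s"] s \<kappa> by simp
        also have "\<dots> \<le> \<kappa> ^ 3 / 6"
          using s \<kappa> by (intro divide_right_mono power_mono) (auto simp: mult_left_le)
        finally have "\<bar>sin (\<kappa> * s) - \<kappa> * s\<bar> / \<kappa> \<le> (\<kappa> ^ 3 / 6) / \<kappa>"
          using \<kappa> by (intro divide_right_mono) auto
        moreover have "\<bar>sin_kernel \<kappa> s - ramp s\<bar> = \<bar>sin (\<kappa> * s) - \<kappa> * s\<bar> / \<kappa>"
        proof -
          have "sin_kernel \<kappa> s - ramp s = (sin (\<kappa> * s) - \<kappa> * s) / \<kappa>"
            using s \<kappa> by (simp add: sin_kernel_def ramp_def diff_divide_distrib)
          then show ?thesis using \<kappa> by simp
        qed
        ultimately show ?thesis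
          using \<kappa> by (simp add: power2_eq_square power3_eq_cube s_def)
      qed (simp add: sin_kernel_def ramp_def)
    qed measurable
    ultimately show ?thesis by simp
  qed
  have i1: "integrable lborel (\<lambda>x. convolve (sin_kernel \<kappa>) g x * g x)"
    by (rule integrable_convolve_times[OF _ sin_kernel_bound[OF \<kappa>] g]) simp
  have i2: "integrable lborel (\<lambda>x. convolve ramp g x * g x)"
    by (rule integrable_convolve_times[OF _ ramp_bound g]) simp
  have "\<bar>self_interaction \<kappa> g - (LBINT x. convolve ramp g x * g x)\<bar>
      = \<bar>LBINT x. convolve (sin_kernel \<kappa>) g x * g x - convolve ramp g x * g x\<bar>"
    using i1 i2 by (simp add: self_interaction_def)
  also have "\<dots> \<le> (LBINT x. \<bar>convolve (sin_kernel \<kappa>) g x * g x - convolve ramp g x * g x\<bar>)"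
    using integral_norm_bound[of lborel "\<lambda>x. convolve (sin_kernel \<kappa>) g x * g x - convolve ramp g x * g x"] by simp
  also have "\<dots> \<le> (LBINT x. \<kappa>\<^sup>2 / 6 * N * \<bar>g x\<bar>)"
  proof (rule integral_mono)
    show "\<bar>convolve (sin_kernel \<kappa>) g x * g x - convolve ramp g x * g x\<bar> \<le> \<kappa>\<^sup>2 / 6 * N * \<bar>g x\<bar>" for x
    proof (cases "0 \<le> x \<and> x \<le> 1")
      case True
      then show ?thesis
        using mult_right_mono[OF diff[of x] abs_ge_zero[of "g x"]]
        by (simp add: abs_mult left_diff_distrib[symmetric])
    qed (use supp in auto)
  qed (use i1 i2 g in auto)
  also have "\<dots> = \<kappa>\<^sup>2 / 6 * N\<^sup>2"
    by (simp add: N_def power2_eq_square)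
  finally show ?thesis by (simp add: N_def)
qed

text \<open>On the support, \<open>ramp (x - y) = x - min x y\<close>. The product term later
  cancels a cosine-sine cross term, and the \<open>min\<close> integral is the summand of
  \<open>A_const\<close>.\<close>

lemma ramp_self_interaction:
  "(LBINT x. convolve ramp g x * g x)
    = (LBINT x. g x) * (LBINT x. x * g x) - (LBINT x. LBINT y. min x y * g x * g y)"
proof -
  have i1: "integrable lborel (\<lambda>x. convolve ramp g x * g x)"
    by (rule integrable_convolve_times[OF _ ramp_bound g]) simp
  have i2: "integrable lborel (\<lambda>x. x * g x)"
    by (rule integrable_times_on_support(1)[of _ 1]) auto
  have "(LBINT y. min x y * g x * g y) = (LBINT y. g y) * (x * g x) - convolve ramp g x * g x" for x
  proof (cases "0 \<le> x \<and> x \<le> 1")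
    case True
    have m: "integrable lborel (\<lambda>y. min x y * g y)"
      by (rule integrable_times_on_support(1)[of _ 1]) (use True in auto)
    have "convolve ramp g x = (LBINT y. x * g y - min x y * g y)"
      unfolding convolve_def
    proof (rule Bochner_Integration.integral_cong[OF refl])
      show "ramp (x - y) * g y = x * g y - min x y * g y" for y
        using True supp by (cases "0 \<le> y \<and> y \<le> 1") (auto simp: ramp_def min_def max_def algebra_simps)
    qed
    also have "\<dots> = x * (LBINT y. g y) - (LBINT y. min x y * g y)"
      using m g by simp
    finally have "(LBINT y. min x y * g y) = x * (LBINT y. g y) - convolve ramp g x" by simp
    moreover have "(LBINT y. min x y * g x * g y) = g x * (LBINT y. min x y * g y)"
      by (simp add: mult_ac flip: integral_mult_right_zero)
    ultimately show ?thesis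
      by (simp only: right_diff_distrib) (simp add: mult_ac)
  qed (use supp in auto)
  then show ?thesis using i1 i2 by simp
qed

end

section \<open>A calculus of limits with linear rate from the right at 0\<close>

definition first_order :: "(real \<Rightarrow> complex) \<Rightarrow> complex \<Rightarrow> bool" where
  "first_order f c \<longleftrightarrow> (\<lambda>e. f e - c) \<in> O[at_right 0](\<lambda>e. complex_of_real e)"

lemma first_orderI:
  assumes "\<And>e. 0 < e \<Longrightarrow> cmod (f e - c) \<le> K * e"
  shows "first_order f c"
  unfolding first_order_def
  by (intro bigoI[of _ K] eventually_at_right_less[THEN eventually_mono]) (use assms in auto)

lemma first_order_const: "first_order (\<lambda>_. c) c"
  by (simp add: first_order_def)

lemma first_order_id: "first_order of_real 0"
  by (simp add: first_order_def)

lemma of_real_bigo_1: "(\<lambda>e. complex_of_real e) \<in> O[at_right 0](\<lambda>_. 1)"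
proof -
  have "((\<lambda>e. complex_of_real e) \<longlongrightarrow> of_real 0) (at_right 0)"
    by (intro tendsto_intros)
  then show ?thesis
    by (intro bigoI_tendsto[of _ _ 0]) auto
qed

lemma first_order_bigo_1: "first_order f c \<Longrightarrow> f \<in> O[at_right 0](\<lambda>_. 1)"
proof -
  assume "first_order f c"
  then have "(\<lambda>e. f e - c) \<in> O[at_right 0](\<lambda>_. 1)"
    unfolding first_order_def by (rule landau_o.big_trans[OF _ of_real_bigo_1])
  then have "(\<lambda>e. (f e - c) + c) \<in> O[at_right 0](\<lambda>_. 1)"
    by (rule sum_in_bigo) auto
  then show ?thesis by simp
qed

lemma first_order_add:
  assumes "first_order f c" "first_order g d"
  shows "first_order (\<lambda>e. f e + g e) (c + d)"
  using sum_in_bigo(1)[OF assms[unfolded first_order_def]] by (simp add: first_order_def algebra_simps)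

text \<open>f g - c d = (f - c) g + c (g - d), with \<open>g\<close> bounded near 0.\<close>

lemma first_order_mult:
  assumes "first_order f c" "first_order g d"
  shows "first_order (\<lambda>e. f e * g e) (c * d)"
proof -
  have "(\<lambda>e. (f e - c) * g e) \<in> O[at_right 0](\<lambda>e. complex_of_real e * 1)"
    using assms(1)[unfolded first_order_def] first_order_bigo_1[OF assms(2)] by (rule landau_o.big.mult)
  moreover have "(\<lambda>e. c * (g e - d)) \<in> O[at_right 0](\<lambda>e. complex_of_real e)"
    using assms(2) unfolding first_order_def by (cases "c = 0") auto
  ultimately have "(\<lambda>e. (f e - c) * g e + c * (g e - d)) \<in> O[at_right 0](\<lambda>e. complex_of_real e)"
    by (intro sum_in_bigo) simp_all
  then show ?thesis by (simp add: first_order_def algebra_simps)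
qed

lemma first_order_minus: "first_order f c \<Longrightarrow> first_order (\<lambda>e. - f e) (- c)"
  using first_order_mult[OF first_order_const[of "- 1"]] by fastforce

lemma first_order_diff:
  assumes "first_order f c" "first_order g d"
  shows "first_order (\<lambda>e. f e - g e) (c - d)"
  using first_order_add[OF assms(1) first_order_minus[OF assms(2)]] by simp

lemma first_order_power:
  "first_order f c \<Longrightarrow> first_order (\<lambda>e. f e ^ n) (c ^ n)"
  by (induction n) (auto intro: first_order_const first_order_mult)

lemma first_order_sum:
  assumes "\<And>j. j \<in> I \<Longrightarrow> first_order (f j) (c j)"
  shows "first_order (\<lambda>e. \<Sum>j\<in>I. f j e) (\<Sum>j\<in>I. c j)"
  using assms by (induction I rule: infinite_finite_induct) (auto intro: first_order_const first_order_add)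

lemma first_order_tendsto:
  assumes "first_order f c"
  shows "(f \<longlongrightarrow> c) (at_right 0)"
proof -
  obtain K where K: "\<forall>\<^sub>F e in at_right 0. cmod (f e - c) \<le> K * cmod (of_real e)"
    using assms unfolding first_order_def by (elim landau_o.bigE) 
  have "((\<lambda>e. f e - c) \<longlongrightarrow> 0) (at_right 0)"
  proof (rule Lim_null_comparison[OF K])
    have "((\<lambda>e. K * cmod (of_real e)) \<longlongrightarrow> K * cmod (of_real 0)) (at_right 0)"
      by (intro tendsto_intros)
    then show "((\<lambda>e. K * cmod (of_real e)) \<longlongrightarrow> 0) (at_right 0)" by simp
  qed
  then show ?thesis by (rule LIM_zero_cancel)
qed

text \<open>1/f - 1/c = - (f - c) / (f c), valid once \<open>f\<close> is nonzero, which holds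
  eventually because its limit is.\<close>

lemma first_order_inverse:
  assumes "first_order f c" "c \<noteq> 0"
  shows "first_order (\<lambda>e. inverse (f e)) (inverse c)"
proof -
  have lim: "((\<lambda>e. inverse (f e)) \<longlongrightarrow> inverse c) (at_right 0)"
    by (intro tendsto_inverse first_order_tendsto assms)
  have "(\<lambda>e. inverse (f e) * inverse c) \<in> O[at_right 0](\<lambda>_. 1)"
    by (rule bigoI_tendsto[of _ _ "inverse c * inverse c"]) (use tendsto_mult_right[OF lim] in auto)
  from landau_o.big.mult[OF assms(1)[unfolded first_order_def] this]
  have "(\<lambda>e. - ((f e - c) * (inverse (f e) * inverse c))) \<in> O[at_right 0](\<lambda>e. complex_of_real e)"
    by simp
  moreover have "\<forall>\<^sub>F e in at_right 0. - ((f e - c) * (inverse (f e) * inverse c)) = inverse (f e) - inverse c"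
    using tendsto_imp_eventually_ne[OF first_order_tendsto[OF assms(1)] assms(2)]
    by eventually_elim (use assms(2) in \<open>simp add: field_simps\<close>)
  ultimately show ?thesis
    unfolding first_order_def by (simp cong: landau_o.big.in_cong)
qed

lemma first_order_divide:
  assumes "first_order f c" "first_order g d" "d \<noteq> 0"
  shows "first_order (\<lambda>e. f e / g e) (c / d)"
  using first_order_mult[OF assms(1) first_order_inverse[OF assms(2,3)]] by (simp add: divide_inverse)

lemmas first_order_intros =
  first_order_const first_order_id first_order_add first_order_mult first_order_diff first_order_minus
  first_order_power first_order_sum first_order_divide

section \<open>First-order expansion of the scattering matrix\<close>

lemma first_order_cong:
  assumes "first_order f c" "\<And>e. 0 < e \<Longrightarrow> f e = g e"
  shows "first_order g c"
proof -
  have "\<forall>\<^sub>F e in at_right (0::real). f e - c = g e - c"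
    using eventually_at_right_less[of "0::real"] by eventually_elim (simp add: assms(2))
  from landau_o.big.in_cong[OF this] show ?thesis
    using assms(1) by (simp add: first_order_def)
qed

lemma first_order_eq_rhs: "first_order f c \<Longrightarrow> c = d \<Longrightarrow> first_order f d"
  by simp

text \<open>An exact identity for each \<open>e > 0\<close>: \<open>c\<close>, \<open>d\<close> and
  \<open>w\<close> hold the remainders of the moments. Sources carry e^2 and the response e^3, so
  the coupling \<open>lam / e ^ 3\<close> leaves a single factor \<open>e\<close> before the
  rank-one term.\<close>

lemma rank_one_scat_expansion:
  fixes v th m c d w :: "'n::finite \<Rightarrow> real" and e lam k :: real
  assumes k: "k > 0" and e: "e > 0" and v: "(\<Sum>j\<in>UNIV. v j) = 0"
  defines "E \<equiv> (\<Sum>j\<in>UNIV. of_real (c j) + \<i> * (of_real (k * th j) + of_real e * of_real (d j)) :: complex)"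
  defines "R \<equiv> (\<lambda>i. 2 / of_nat CARD('n) * E - 2 * \<i> * (of_real (k * th i) + of_real e * of_real (d i)))"
  defines "M \<equiv> \<i> * E\<^sup>2 / of_real k / of_nat CARD('n)
    + (\<Sum>j\<in>UNIV. of_real (c j) * of_real (k * th j) + of_real (v j) * of_real (d j)
        + of_real e * of_real (c j) * of_real (d j)
        + \<i> * (of_real (k * th j) + of_real e * of_real (d j))\<^sup>2) / of_real k
    - (\<Sum>j\<in>UNIV. of_real (w j))"
  shows "rank_one_scat (lam / e ^ 3) k (\<lambda>j. e * (v j + e * c j)) (\<lambda>j. e\<^sup>2 * (k * th j + e * d j))
      (\<Sum>j\<in>UNIV. e ^ 3 * (v j * th j - m j + e * w j)) $ i $ j
    = 2 / of_nat CARD('n) - (if i = j then 1 else 0)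
      - of_real e * (\<i> * of_real lam * R i * R j)
        / (2 * of_real k * (1 + of_real lam * of_real (\<Sum>j\<in>UNIV. m j) + of_real e * of_real lam * M))"
proof -
  let ?C = "\<lambda>j. e * (v j + e * c j)" and ?D = "\<lambda>j. e\<^sup>2 * (k * th j + e * d j)"
  let ?W = "\<Sum>j\<in>UNIV. e ^ 3 * (v j * th j - m j + e * w j)"
  define \<epsilon> where "\<epsilon> = complex_of_real e"
  have \<epsilon>: "\<epsilon> \<noteq> 0" using e by (simp add: \<epsilon>_def)
  \<comment> \<open>The only contribution of order \<open>e\<close> is the total mean, which is zero
    by \<open>v\<close>.\<close>
  have "(\<Sum>j\<in>UNIV. complex_of_real (?C j) + \<i> * of_real (?D j))
      = (\<Sum>j\<in>UNIV. \<epsilon> * of_real (v j) + \<epsilon>\<^sup>2 * (of_real (c j) + \<i> * (of_real (k * th j) + \<epsilon> * of_real (d j))))"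
    by (rule sum.cong) (simp_all add: \<epsilon>_def algebra_simps power2_eq_square)
  also have "\<dots> = \<epsilon> * of_real (\<Sum>j\<in>UNIV. v j) + \<epsilon>\<^sup>2 * E"
    by (subst sum.distrib) (simp only: sum_distrib_left E_def \<epsilon>_def of_real_sum)
  finally have sumE: "(\<Sum>j\<in>UNIV. complex_of_real (?C j) + \<i> * of_real (?D j)) = \<epsilon>\<^sup>2 * E"
    by (simp add: v)
  have src: "source ?C ?D i = \<epsilon>\<^sup>2 * R i" for i
    unfolding source_def sumE R_def by (simp add: \<epsilon>_def algebra_simps)
  define G where "G = (\<Sum>j\<in>UNIV. of_real (c j) * of_real (k * th j) + of_real (v j) * of_real (d j)
        + of_real e * of_real (c j) * of_real (d j)
        + \<i> * (of_real (k * th j) + of_real e * of_real (d j))\<^sup>2)"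
  have "(\<Sum>j\<in>UNIV. (complex_of_real (?C j) + \<i> * of_real (?D j)) * of_real (?D j))
      = (\<Sum>j\<in>UNIV. \<epsilon> ^ 3 * of_real k * of_real (v j * th j)
        + \<epsilon> ^ 4 * (of_real (c j) * of_real (k * th j) + of_real (v j) * of_real (d j)
        + of_real e * of_real (c j) * of_real (d j)
        + \<i> * (of_real (k * th j) + of_real e * of_real (d j))\<^sup>2))"
    by (rule sum.cong) (simp_all add: \<epsilon>_def algebra_simps power2_eq_square power_numeral_reduce)
  also have "\<dots> = \<epsilon> ^ 3 * of_real k * of_real (\<Sum>j\<in>UNIV. v j * th j) + \<epsilon> ^ 4 * G"
    by (subst sum.distrib) (simp only: sum_distrib_left G_def of_real_sum)
  finally have sumG: "(\<Sum>j\<in>UNIV. (complex_of_real (?C j) + \<i> * of_real (?D j)) * of_real (?D j))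
      = \<epsilon> ^ 3 * of_real k * of_real (\<Sum>j\<in>UNIV. v j * th j) + \<epsilon> ^ 4 * G" .
  have "?W = e ^ 3 * ((\<Sum>j\<in>UNIV. v j * th j) - (\<Sum>j\<in>UNIV. m j)) + e ^ 4 * (\<Sum>j\<in>UNIV. w j)"
    by (simp add: sum_distrib_left algebra_simps power_numeral_reduce flip: sum.distrib sum_subtractf)
  then have W: "complex_of_real ?W = \<epsilon> ^ 3 * (of_real (\<Sum>j\<in>UNIV. v j * th j) - of_real (\<Sum>j\<in>UNIV. m j))
      + \<epsilon> ^ 4 * (\<Sum>j\<in>UNIV. of_real (w j))"
    by (simp add: \<epsilon>_def)
  \<comment> \<open>The sum of \<open>v j * th j\<close> occurs in \<open>sumG\<close> and in
    \<open>W\<close> with the same coefficient once \<open>k\<close> is divided out, and cancels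
    here.\<close>
  have resp: "response k ?C ?D ?W = \<epsilon> ^ 3 * (of_real (\<Sum>j\<in>UNIV. m j) + \<epsilon> * M)"
    unfolding response_def sumE sumG W M_def G_def[symmetric] using k
    by (simp add: field_simps power2_eq_square power_numeral_reduce del: of_real_sum)
  have den: "1 + of_real (lam / e ^ 3) * response k ?C ?D ?W
      = 1 + of_real lam * of_real (\<Sum>j\<in>UNIV. m j) + \<epsilon> * of_real lam * M"
    unfolding resp using \<epsilon> by (simp add: \<epsilon>_def[symmetric] distrib_left mult_ac del: of_real_sum)
  have num: "\<i> * of_real (lam / e ^ 3) * source ?C ?D i * source ?C ?D j
      = \<epsilon> * (\<i> * of_real lam * R i * R j)"
    unfolding src using \<epsilon> by (simp add: \<epsilon>_def[symmetric] power2_eq_square power3_eq_cube field_simps)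
  show ?thesis
    unfolding rank_one_scat_def vec_lambda_beta den num \<epsilon>_def ..
qed

text \<open>Whether the factor \<open>e\<close> of the rank-one term survives depends on the
  denominator: if its limit 1 - \<open>lam0 * A\<close> is nonzero the term vanishes linearly,
  otherwise the denominator carries a factor \<open>e\<close> of its own.\<close>

lemma rank_one_scat_first_order:
  fixes v th m :: "'n::finite \<Rightarrow> real" and c d w :: "'n \<Rightarrow> real \<Rightarrow> real" and lam :: "real \<Rightarrow> real"
  assumes k: "k > 0" and v: "(\<Sum>j\<in>UNIV. v j) = 0"
    and c: "\<And>j. first_order (\<lambda>e. of_real (c j e)) 0"
    and d: "\<And>j. first_order (\<lambda>e. of_real (d j e)) 0"
    and w: "\<And>j. first_order (\<lambda>e. of_real (w j e)) 0"
    and lam: "first_order (\<lambda>e. of_real ((lam e - lam0) / e)) (of_real lam1)"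
    and lam1: "lam1 \<noteq> 0"
    and A: "A = - (\<Sum>j\<in>UNIV. m j)"
    and \<beta>: "\<beta> = (if lam0 * A = 1 then 1 / (lam1 * A\<^sup>2) else 0)"
  shows "first_order (\<lambda>e. rank_one_scat (lam e / e ^ 3) k (\<lambda>j. e * (v j + e * c j e))
      (\<lambda>j. e\<^sup>2 * (k * th j + e * d j e)) (\<Sum>j\<in>UNIV. e ^ 3 * (v j * th j - m j + e * w j e)) $ i $ j)
    (scat_limit th \<beta> k $ i $ j)"
proof -
  define n where "n = complex_of_nat CARD('n)"
  have n: "n \<noteq> 0" by (simp add: n_def)
  define E where "E = (\<lambda>e. \<Sum>j\<in>UNIV. of_real (c j e) + \<i> * (of_real (k * th j) + of_real e * of_real (d j e)) :: complex)"
  define R where "R = (\<lambda>i e. 2 / n * E e - 2 * \<i> * (of_real (k * th i) + of_real e * of_real (d i e)))"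
  define M where "M = (\<lambda>e. \<i> * (E e)\<^sup>2 / of_real k / n
    + (\<Sum>j\<in>UNIV. of_real (c j e) * of_real (k * th j) + of_real (v j) * of_real (d j e)
        + of_real e * of_real (c j e) * of_real (d j e)
        + \<i> * (of_real (k * th j) + of_real e * of_real (d j e))\<^sup>2) / of_real k
    - (\<Sum>j\<in>UNIV. of_real (w j e)))"
  define s where "s = (\<Sum>l\<in>UNIV. th l)"
  have E: "first_order E (\<i> * of_real (k * s))"
    unfolding E_def
    by (rule first_order_eq_rhs, (rule first_order_intros c d)+) (simp add: s_def sum_distrib_left mult_ac)
  define u where "u = (\<lambda>i. complex_of_real s / n - of_real (th i))"
  have R: "first_order (R i) (2 * \<i> * of_real k * u i)" for i
    unfolding R_def by (rule first_order_eq_rhs, (rule first_order_intros d E)+) (simp add: u_def algebra_simps)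
  have k0: "complex_of_real k \<noteq> 0" using k by simp
  have M: "first_order M (- \<i> * of_real k * of_real (B_const th))"
  proof -
    \<comment> \<open>The zeros are the limits of \<open>e\<close>, \<open>c\<close>,
      \<open>d\<close> and \<open>w\<close>; the limit is kept in the shape of \<open>M\<close> so
      that the closure rules apply syntactically.\<close>
    have "first_order M (\<i> * (\<i> * of_real (k * s))\<^sup>2 / of_real k / n
        + (\<Sum>j\<in>UNIV. 0 * of_real (k * th j) + of_real (v j) * 0 + 0 * 0 * 0
          + \<i> * (of_real (k * th j) + 0 * 0)\<^sup>2) / of_real k - (\<Sum>j::'n\<in>UNIV. 0))"
      unfolding M_def by (intro first_order_intros c d w E k0 n)
    note lim = this
    define q where "q = (\<Sum>j\<in>UNIV. (th j)\<^sup>2)"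
    have S: "(\<Sum>j\<in>UNIV. 0 * of_real (k * th j) + of_real (v j) * 0 + 0 * 0 * 0
          + \<i> * (of_real (k * th j) + 0 * 0)\<^sup>2) = \<i> * of_real k * of_real k * complex_of_real q"
      by (simp add: q_def sum_distrib_left power2_eq_square mult_ac)
    have B: "complex_of_real (B_const th) = (of_real s)\<^sup>2 / n - of_real q"
      by (simp add: B_const_def n_def s_def q_def)
    show ?thesis
      using lim unfolding S B by (rule first_order_eq_rhs) (use k0 n in \<open>simp add: power2_eq_square field_simps\<close>)
  qed
  define l1 where "l1 = (\<lambda>e. complex_of_real ((lam e - lam0) / e))"
  have l1: "first_order l1 (of_real lam1)" unfolding l1_def by (rule lam)
  have lam_eq: "complex_of_real (lam e) = of_real lam0 + of_real e * l1 e" if "0 < e" for e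
    using that by (simp add: l1_def)
  have "first_order (\<lambda>e. of_real lam0 + of_real e * l1 e) (of_real lam0 + 0 * of_real lam1)"
    by (intro first_order_intros l1)
  then have lam': "first_order (\<lambda>e. complex_of_real (lam e)) (of_real lam0)"
    by (rule first_order_cong[OF first_order_eq_rhs]) (simp_all add: lam_eq)
  define X where "X = (\<lambda>e. 1 - of_real (lam e) * of_real A + of_real e * of_real (lam e) * M e)"
  define L where "L = 2 * \<i> * of_real k * of_real \<beta> * of_real (Pi_mat th i j) / (1 + \<i> * of_real k * of_real \<beta> * of_real (B_const th))"
  have Pi: "u i * u j = of_real (Pi_mat th i j)"
    by (simp add: u_def Pi_mat_def s_def n_def)
  have main: "first_order (\<lambda>e. of_real e * (\<i> * of_real (lam e) * R i e * R j e) / (2 * of_real k * X e)) L"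
  proof (cases "lam0 * A = 1")
    case False
    have X: "first_order X (1 - of_real lam0 * of_real A + 0 * of_real lam0 * (- \<i> * of_real k * of_real (B_const th)))"
      unfolding X_def by (intro first_order_intros lam' M)
    have "complex_of_real lam0 * of_real A \<noteq> 1"
      using False by (metis of_real_eq_1_iff of_real_mult)
    then have ne: "2 * of_real k * (1 - of_real lam0 * of_real A + 0 * of_real lam0 * (- \<i> * of_real k * of_real (B_const th))) \<noteq> 0"
      using k by simp
    have "first_order (\<lambda>e. of_real e * (\<i> * of_real (lam e) * R i e * R j e))
        (0 * (\<i> * of_real lam0 * (2 * \<i> * of_real k * u i)
          * (2 * \<i> * of_real k * u j)))"
      by (intro first_order_intros lam' R)
    moreover have "first_order (\<lambda>e. 2 * of_real k * X e)
        (2 * of_real k * (1 - of_real lam0 * of_real A + 0 * of_real lam0 * (- \<i> * of_real k * of_real (B_const th))))"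
      by (intro first_order_intros X)
    ultimately have "first_order (\<lambda>e. of_real e * (\<i> * of_real (lam e) * R i e * R j e) / (2 * of_real k * X e)) 0"
      by (rule first_order_eq_rhs[OF first_order_divide[OF _ _ ne]]) simp
    moreover have "L = 0" using False by (simp add: L_def \<beta>)
    ultimately show ?thesis by simp
  next
    case True
    \<comment> \<open>At resonance \<open>Y\<close> is the denominator \<open>X\<close> with its
      factor \<open>e\<close> removed; that factor cancels the one in the numerator.\<close>
    define Y where "Y = (\<lambda>e. of_real (lam e) * M e - l1 e * of_real A)"
    define Y0 where "Y0 = of_real lam0 * (- \<i> * of_real k * of_real (B_const th)) - of_real lam1 * of_real A"
    have Y: "first_order Y Y0"
      unfolding Y_def Y0_def by (intro first_order_intros lam' M l1)
    have "A \<noteq> 0" using True by auto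
    then have "lam0 = 1 / A" using True by (simp add: eq_divide_eq)
    \<comment> \<open>The limit of \<open>M\<close> is purely imaginary, so it cannot compensate the
      real term, which is nonzero by \<open>lam1 \<noteq> 0\<close>.\<close>
    have "Re Y0 = - (lam1 * A)" by (simp add: Y0_def)
    then have "Y0 \<noteq> 0" using lam1 \<open>A \<noteq> 0\<close> by auto
    then have ne: "2 * of_real k * Y0 \<noteq> 0" using k by simp
    define Q where "Q = \<i> * of_real lam0 * (2 * \<i> * of_real k * u i)
        * (2 * \<i> * of_real k * u j) / (2 * of_real k * Y0)"
    have lim: "first_order (\<lambda>e. \<i> * of_real (lam e) * R i e * R j e / (2 * of_real k * Y e)) Q"
      unfolding Q_def by (rule first_order_divide[OF _ _ ne]) (intro first_order_intros lam' R Y)+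
    have X_eq: "X e = of_real e * Y e" if "0 < e" for e
    proof -
      have "1 - of_real (lam e) * of_real A = - of_real e * l1 e * complex_of_real A"
        unfolding lam_eq[OF that] using True by (simp add: algebra_simps flip: of_real_mult)
      then show ?thesis unfolding X_def Y_def by (simp add: algebra_simps)
    qed
    have "Q = \<i> * of_real lam0 * (2 * \<i> * of_real k) * (2 * \<i> * of_real k) * of_real (Pi_mat th i j) / (2 * of_real k * Y0)"
      unfolding Q_def Pi[symmetric] by (simp add: mult_ac)
    also have "\<dots> = - (2 * \<i> * of_real k * of_real lam0 * of_real (Pi_mat th i j)) / Y0"
      using k by (simp add: field_simps)
    also have "\<dots> = L"
    proof -
      \<comment> \<open>Factoring out \<open>lam1 * A\<close> turns \<open>lam0\<close> into
        \<open>lam0 / (lam1 * A)\<close>, which is \<open>\<beta>\<close> because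
        \<open>lam0 = 1 / A\<close>.\<close>
      have "Y0 = - (of_real (lam1 * A) * (1 + \<i> * of_real k * of_real \<beta> * of_real (B_const th)))"
        using True \<open>A \<noteq> 0\<close> lam1 by (simp add: Y0_def \<beta> \<open>lam0 = 1 / A\<close> field_simps power2_eq_square)
      moreover have "complex_of_real lam0 = of_real (lam1 * A) * of_real \<beta>"
        using True \<open>A \<noteq> 0\<close> lam1 by (simp add: \<beta> \<open>lam0 = 1 / A\<close> field_simps power2_eq_square)
      ultimately show ?thesis
        using \<open>A \<noteq> 0\<close> lam1 unfolding L_def by (simp add: mult_ac)
    qed
    finally have "Q = L" .
    show ?thesis
      by (rule first_order_cong[OF lim[unfolded \<open>Q = L\<close>]]) (simp add: X_eq mult.assoc)
  qed
  have "first_order (\<lambda>e. 2 / n - (if i = j then 1 else 0)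
      - of_real e * (\<i> * of_real (lam e) * R i e * R j e) / (2 * of_real k * X e)) (2 / n - (if i = j then 1 else 0) - L)"
    by (intro first_order_diff first_order_const main)
  then have *: "first_order (\<lambda>e. 2 / n - (if i = j then 1 else 0)
      - of_real e * (\<i> * of_real (lam e) * R i e * R j e) / (2 * of_real k * X e)) (scat_limit th \<beta> k $ i $ j)"
    by (simp add: scat_limit_def L_def n_def)
  show ?thesis
  proof (rule first_order_cong[OF *])
    fix e :: real assume e: "0 < e"
    show "2 / n - (if i = j then 1 else 0)
      - of_real e * (\<i> * of_real (lam e) * R i e * R j e) / (2 * of_real k * X e)
      = rank_one_scat (lam e / e ^ 3) k (\<lambda>j. e * (v j + e * c j e))
      (\<lambda>j. e\<^sup>2 * (k * th j + e * d j e)) (\<Sum>j\<in>UNIV. e ^ 3 * (v j * th j - m j + e * w j e)) $ i $ j"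
      unfolding rank_one_scat_expansion[OF k e v] X_def M_def R_def E_def n_def A by simp
  qed
qed

section \<open>The limiting vertex condition\<close>

text \<open>Here \<open>p a\<close> is the vertex value, so the outward derivative is i k (p - 2
  delta). The first condition makes all difference quotients equal to one number, hence
  \<open>p\<close> is affine in \<open>th\<close>; Kirchhoff's condition fixes its mean as 2/n, and
  reinserting \<open>p\<close> gives a scalar linear equation for the slope.\<close>

lemma beta_vertex_conditions_iff:
  fixes th :: "'n::finite \<Rightarrow> real" and p :: "'n \<Rightarrow> complex" and \<beta> k :: real
  assumes inj: "inj th" and k: "k \<noteq> 0"
  defines "n \<equiv> of_nat CARD('n)"
  defines "\<mu> \<equiv> of_real (\<Sum>l\<in>UNIV. th l) / n"
  shows "(\<forall>a b. a \<noteq> b \<longrightarrow> (p a - p b) / of_real (th a - th b)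
      = of_real \<beta> * (\<Sum>l\<in>UNIV. of_real (th l) * (\<i> * of_real k * (p l - 2 * (if l = i then 1 else 0)))))
    \<and> (\<Sum>l\<in>UNIV. \<i> * of_real k * (p l - 2 * (if l = i then 1 else 0))) = 0
    \<longleftrightarrow> (\<forall>a. p a = 2 / n + (of_real (th a) - \<mu>)
        * (2 * \<i> * of_real k * of_real \<beta> * (\<mu> - of_real (th i)) / (1 + \<i> * of_real k * of_real \<beta> * of_real (B_const th))))"
    (is "?vertex \<longleftrightarrow> (\<forall>a. p a = 2 / n + (of_real (th a) - \<mu>) * ?X)")
proof -
  have n: "n \<noteq> 0" by (simp add: n_def)
  define \<Theta> where "\<Theta> = (\<lambda>a. complex_of_real (th a))"
  define \<kappa> where "\<kappa> = \<i> * complex_of_real k"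
  have \<kappa>: "\<kappa> \<noteq> 0" using k by (simp add: \<kappa>_def)
  define b where "b = complex_of_real \<beta>"
  define B where "B = complex_of_real (B_const th)"
  have \<mu>: "(\<Sum>a\<in>UNIV. \<Theta> a) = n * \<mu>" using n by (simp add: \<mu>_def \<Theta>_def)
  have B: "(\<Sum>a\<in>UNIV. \<Theta> a * \<Theta> a) = n * \<mu> * \<mu> - B"
    using n by (simp add: B_def B_const_def \<mu>_def \<Theta>_def n_def power2_eq_square)
  \<comment> \<open>\<open>b\<close> and \<open>B\<close> are real and \<open>\<kappa>\<close> is
    imaginary, so the denominator never vanishes.\<close>
  have "Re (1 + \<kappa> * b * B) = 1" by (simp add: \<kappa>_def b_def B_def)
  then have den: "1 + \<kappa> * b * B \<noteq> 0" by (metis zero_complex.sel(1) zero_neq_one)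
  define x0 where "x0 = 2 * \<kappa> * b * (\<mu> - \<Theta> i) / (1 + \<kappa> * b * B)"
  have T: "complex_of_real (th a) = \<Theta> a" for a by (simp add: \<Theta>_def)
  have X: "?X = x0"
    by (simp add: x0_def \<kappa>_def b_def B_def \<Theta>_def mult_ac)
  have delta: "(\<Sum>l\<in>UNIV. \<Theta> l * (\<kappa> * (p l - 2 * (if l = i then 1 else 0)))) = \<kappa> * ((\<Sum>l\<in>UNIV. \<Theta> l * p l) - 2 * \<Theta> i)"
    "(\<Sum>l\<in>UNIV. \<kappa> * (p l - 2 * (if l = i then 1 else 0))) = \<kappa> * ((\<Sum>l\<in>UNIV. p l) - 2)"
  proof -
    have "(\<Sum>l\<in>UNIV. \<Theta> l * (\<kappa> * (p l - 2 * (if l = i then 1 else 0))))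
        = (\<Sum>l\<in>UNIV. \<kappa> * (\<Theta> l * p l) - (if l = i then 2 * \<kappa> * \<Theta> l else 0))"
      by (rule sum.cong) (simp_all add: algebra_simps)
    then show "(\<Sum>l\<in>UNIV. \<Theta> l * (\<kappa> * (p l - 2 * (if l = i then 1 else 0)))) = \<kappa> * ((\<Sum>l\<in>UNIV. \<Theta> l * p l) - 2 * \<Theta> i)"
      by (simp add: sum_subtractf right_diff_distrib sum_distrib_left)
    show "(\<Sum>l\<in>UNIV. \<kappa> * (p l - 2 * (if l = i then 1 else 0))) = \<kappa> * ((\<Sum>l\<in>UNIV. p l) - 2)"
      by (simp add: sum_subtractf flip: sum_distrib_left)
  qed
  have distinct: "\<Theta> a \<noteq> \<Theta> b" if "a \<noteq> b" for a b
    using that inj by (auto simp: \<Theta>_def dest: injD)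
  have vertex: "?vertex \<longleftrightarrow> (\<forall>a c. a \<noteq> c \<longrightarrow> (p a - p c) / (\<Theta> a - \<Theta> c)
      = b * (\<kappa> * ((\<Sum>l\<in>UNIV. \<Theta> l * p l) - 2 * \<Theta> i))) \<and> (\<Sum>l\<in>UNIV. p l) = 2"
    unfolding b_def[symmetric] \<kappa>_def[symmetric] of_real_diff T delta using \<kappa> by simp
  have moments: "(\<Sum>l\<in>UNIV. 2 / n + (\<Theta> l - \<mu>) * x) = 2"
    "(\<Sum>l\<in>UNIV. \<Theta> l * (2 / n + (\<Theta> l - \<mu>) * x)) = 2 * \<mu> - B * x" for x
  proof -
    have "(\<Sum>l\<in>UNIV. 2 / n + (\<Theta> l - \<mu>) * x) = n * (2 / n) + ((\<Sum>l\<in>UNIV. \<Theta> l) - n * \<mu>) * x"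
      by (simp add: sum.distrib sum_subtractf n_def flip: sum_distrib_right)
    then show "(\<Sum>l\<in>UNIV. 2 / n + (\<Theta> l - \<mu>) * x) = 2"
      using n by (simp add: \<mu>)
    have "(\<Sum>l\<in>UNIV. \<Theta> l * (2 / n + (\<Theta> l - \<mu>) * x))
        = (\<Sum>l\<in>UNIV. \<Theta> l * (2 / n) + \<Theta> l * \<Theta> l * x - \<Theta> l * (\<mu> * x))"
      by (rule sum.cong) (simp_all add: algebra_simps)
    also have "\<dots> = n * \<mu> * (2 / n) + (n * \<mu> * \<mu> - B) * x - n * \<mu> * (\<mu> * x)"
      by (simp only: sum.distrib sum_subtractf \<mu> B flip: sum_distrib_right)
    also have "\<dots> = 2 * \<mu> - B * x"
      using n by (simp add: algebra_simps)
    finally show "(\<Sum>l\<in>UNIV. \<Theta> l * (2 / n + (\<Theta> l - \<mu>) * x)) = 2 * \<mu> - B * x" .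
  qed
  have fixpoint: "b * (\<kappa> * (2 * \<mu> - B * x - 2 * \<Theta> i)) = x \<longleftrightarrow> x = x0" for x
  proof -
    have "b * (\<kappa> * (2 * \<mu> - B * x - 2 * \<Theta> i)) = x \<longleftrightarrow> x * (1 + \<kappa> * b * B) = 2 * \<kappa> * b * (\<mu> - \<Theta> i)"
      by (auto simp: algebra_simps)
    then show ?thesis unfolding x0_def using den by (simp add: eq_divide_eq)
  qed
  show ?thesis
    unfolding vertex X unfolding T
  proof
    assume L: "(\<forall>a c. a \<noteq> c \<longrightarrow> (p a - p c) / (\<Theta> a - \<Theta> c)
      = b * (\<kappa> * ((\<Sum>l\<in>UNIV. \<Theta> l * p l) - 2 * \<Theta> i))) \<and> (\<Sum>l\<in>UNIV. p l) = 2"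
    define x where "x = b * (\<kappa> * ((\<Sum>l\<in>UNIV. \<Theta> l * p l) - 2 * \<Theta> i))"
    have diff: "p a - p c = (\<Theta> a - \<Theta> c) * x" for a c
      using L distinct[of a c] unfolding x_def[symmetric] by (cases "a = c") (auto simp: divide_eq_eq mult.commute)
    have p: "p a = 2 / n + (\<Theta> a - \<mu>) * x" for a
    proof -
      \<comment> \<open>Summing the differences over all edges recovers \<open>p a\<close> from the
        known total 2.\<close>
      have "n * p a - 2 = (\<Sum>c\<in>UNIV. p a - p c)"
        using L by (simp add: sum_subtractf n_def)
      also have "\<dots> = (n * \<Theta> a - n * \<mu>) * x"
        unfolding diff by (simp add: sum_subtractf n_def \<mu>[unfolded n_def] flip: sum_distrib_right)
      finally show ?thesis using n by (simp add: field_simps)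
    qed
    have "x = b * (\<kappa> * (2 * \<mu> - B * x - 2 * \<Theta> i))"
      by (subst x_def, subst p) (simp only: moments)
    then have "x = x0" using fixpoint[of x] by simp
    then show "\<forall>a. p a = 2 / n + (\<Theta> a - \<mu>) * x0" using p by blast
  next
    assume R: "\<forall>a. p a = 2 / n + (\<Theta> a - \<mu>) * x0"
    define x where "x = x0"
    have p: "p = (\<lambda>a. 2 / n + (\<Theta> a - \<mu>) * x)" using R by (auto simp: x_def)
    have x: "b * (\<kappa> * (2 * \<mu> - B * x - 2 * \<Theta> i)) = x"
      using fixpoint[of x] by (simp add: x_def)
    show "(\<forall>a c. a \<noteq> c \<longrightarrow> (p a - p c) / (\<Theta> a - \<Theta> c)
      = b * (\<kappa> * ((\<Sum>l\<in>UNIV. \<Theta> l * p l) - 2 * \<Theta> i))) \<and> (\<Sum>l\<in>UNIV. p l) = 2"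
      unfolding p moments x using distinct by (auto simp flip: left_diff_distrib)
  qed
qed

lemma outer_wave_vertex_data:
  fixes s :: complex and i j :: 'a
  assumes k: "k > 0"
  defines "\<psi> \<equiv> (\<lambda>x::real. (if j = i then exp (- \<i> * complex_of_real k * complex_of_real x) else 0)
    + s * exp (\<i> * complex_of_real k * complex_of_real x))"
  shows "\<psi> 0 = (if j = i then 1 else 0) + s"
    and "edge_deriv \<psi> 0 = \<i> * of_real k * (s - (if j = i then 1 else 0))"
proof -
  \<comment> \<open>A free wave is an edge wave without forcing, so its vertex data follow from
    \<open>edge_wave_0\<close>.\<close>
  have "\<psi> = edge_wave k (\<lambda>_. 0) ((if j = i then 1 else 0) + s) (\<i> * of_real k * (s - (if j = i then 1 else 0))) 0"
  proof
    fix x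
    have "\<psi> x = (if j = i then 1 else 0) * exp (- \<i> * complex_of_real k * complex_of_real x)
        + s * exp (\<i> * complex_of_real k * complex_of_real x)"
      by (simp add: \<psi>_def)
    then show "\<psi> x = edge_wave k (\<lambda>_. 0) ((if j = i then 1 else 0) + s) (\<i> * of_real k * (s - (if j = i then 1 else 0))) 0 x"
      unfolding incoming_outgoing_wave using k by (simp add: edge_wave_def mult_ac)
  qed
  then show "\<psi> 0 = (if j = i then 1 else 0) + s"
    "edge_deriv \<psi> 0 = \<i> * of_real k * (s - (if j = i then 1 else 0))"
    using edge_wave_0[of k "\<lambda>_. 0"] k by simp_all
qed

lemma is_beta_scat_matrix_iff:
  fixes th :: "'n::finite \<Rightarrow> real"
  assumes inj: "inj th" and k: "k > 0"
  shows "is_beta_scat_matrix th \<beta> k S \<longleftrightarrow> S = scat_limit th \<beta> k"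
proof -
  have split: "\<i> * of_real k * (S $ i $ l - (if l = i then 1 else 0))
      = \<i> * of_real k * (((if l = i then 1 else 0) + S $ i $ l) - 2 * (if l = i then 1 else 0))" for i l
    by simp
  have row: "(if a = i then 1 else 0) + S $ i $ a = 2 / of_nat CARD('n)
      + (of_real (th a) - of_real (\<Sum>l\<in>UNIV. th l) / of_nat CARD('n))
        * (2 * \<i> * of_real k * of_real \<beta> * (of_real (\<Sum>l\<in>UNIV. th l) / of_nat CARD('n) - of_real (th i))
          / (1 + \<i> * of_real k * of_real \<beta> * of_real (B_const th)))
      \<longleftrightarrow> S $ i $ a = scat_limit th \<beta> k $ i $ a" for i a
  proof -
    define Z where "Z = 1 + \<i> * of_real k * of_real \<beta> * complex_of_real (B_const th)"
    define m where "m = (\<Sum>l\<in>UNIV. th l) / real CARD('n)"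
    have m: "complex_of_real (\<Sum>l\<in>UNIV. th l) / of_nat CARD('n) = of_real m" by (simp add: m_def)
    have solve: "L = t - d - q \<Longrightarrow> y = - q \<Longrightarrow> d + s = t + y \<longleftrightarrow> s = L" for L t d q y s :: complex
      by (auto simp: algebra_simps)
    have 1: "scat_limit th \<beta> k $ i $ a = 2 / of_nat CARD('n) - (if a = i then 1 else 0)
      - 2 * \<i> * of_real k * of_real \<beta> * of_real ((m - th i) * (m - th a)) / Z"
      by (simp add: scat_limit_def Pi_mat_def m_def Z_def eq_commute[of i])
    \<comment> \<open>This sign flip produces the minus sign in front of the \<open>Pi_mat\<close>
      term.\<close>
    have "complex_of_real (th a) - of_real m = - of_real (m - th a)"
      "complex_of_real m - of_real (th i) = of_real (m - th i)" by simp_all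
    then have 2: "(of_real (th a) - of_real m) * (2 * \<i> * of_real k * of_real \<beta> * (of_real m - of_real (th i)) / Z)
      = - (2 * \<i> * of_real k * of_real \<beta> * complex_of_real ((m - th i) * (m - th a)) / Z)"
      unfolding of_real_mult by (simp add: mult_ac del: of_real_diff)
    show ?thesis
      unfolding m Z_def[symmetric] by (rule solve[OF 1 2])
  qed
  show ?thesis
    unfolding is_beta_scat_matrix_def Let_def outer_wave_vertex_data[OF k] split
      beta_vertex_conditions_iff[OF inj less_imp_neq[OF k, symmetric]] row
    by (simp add: vec_eq_iff)
qed

section \<open>From asymptotics to a bound on (0,1], and the conclusion\<close>

lemma first_order_uniform_bound:
  assumes f: "first_order f c" and bound: "\<And>e. cmod (f e) \<le> b"
  shows "\<exists>K\<ge>0. \<forall>e\<in>{0<..1}. cmod (f e - c) \<le> K * e"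
proof -
  obtain K where K: "\<forall>\<^sub>F e in at_right 0. cmod (f e - c) \<le> K * cmod (of_real e)"
    using f unfolding first_order_def by (elim landau_o.bigE)
  then obtain r where r: "r > 0" "\<And>e. 0 < e \<Longrightarrow> e < r \<Longrightarrow> cmod (f e - c) \<le> K * e"
    unfolding eventually_at_right_field by auto
  \<comment> \<open>Below \<open>r\<close> the asymptotic constant serves; from \<open>r\<close> on,
    the trivial bound \<open>b + cmod c\<close> is at most its quotient by \<open>r\<close> times
    \<open>e\<close>.\<close>
  define L where "L = max \<bar>K\<bar> ((b + cmod c) / r)"
  have "cmod (f e - c) \<le> L * e" if e: "e \<in> {0<..1}" for e
  proof (cases "e < r")
    case True
    then have "cmod (f e - c) \<le> K * e" using r e by simp
    also have "\<dots> \<le> L * e" using e by (intro mult_right_mono) (auto simp: L_def)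
    finally show ?thesis .
  next
    case False
    have "0 \<le> b + cmod c" using order_trans[OF norm_ge_zero bound[of 0]] by simp
    have "cmod (f e - c) \<le> b + cmod c"
      using norm_triangle_ineq4[of "f e" c] bound[of e] by linarith
    also have "\<dots> = (b + cmod c) / r * r" using r by simp
    also have "\<dots> \<le> L * e"
      using False r e \<open>0 \<le> b + cmod c\<close> by (intro mult_mono) (auto simp: L_def le_max_iff_disj)
    finally show ?thesis .
  qed
  moreover have "L \<ge> 0" by (simp add: L_def le_max_iff_disj)
  ultimately show ?thesis by blast
qed

lemma onorm_matrix_le_sum:
  fixes M :: "complex^'n::finite^'m::finite"
  shows "onorm (\<lambda>v. M *v v) \<le> (\<Sum>i\<in>UNIV. \<Sum>j\<in>UNIV. cmod (M $ i $ j))"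
proof (rule onorm_le)
  fix v :: "complex^'n"
  have "norm (M *v v) \<le> (\<Sum>i\<in>UNIV. cmod ((M *v v) $ i))"
    unfolding norm_vec_def by (rule L2_set_le_sum) simp
  also have "\<dots> \<le> (\<Sum>i\<in>UNIV. \<Sum>j\<in>UNIV. cmod (M $ i $ j) * norm v)"
  proof (rule sum_mono)
    fix i
    have "cmod ((M *v v) $ i) \<le> (\<Sum>j\<in>UNIV. cmod (M $ i $ j * v $ j))"
      unfolding matrix_vector_mult_def vec_lambda_beta by (rule norm_sum)
    also have "\<dots> \<le> (\<Sum>j\<in>UNIV. cmod (M $ i $ j) * norm v)"
      by (intro sum_mono) (simp add: norm_mult mult_left_mono Finite_Cartesian_Product.norm_nth_le)
    finally show "cmod ((M *v v) $ i) \<le> (\<Sum>j\<in>UNIV. cmod (M $ i $ j) * norm v)" .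
  qed
  also have "\<dots> = (\<Sum>i\<in>UNIV. \<Sum>j\<in>UNIV. cmod (M $ i $ j)) * norm v"
    by (simp add: sum_distrib_right)
  finally show "norm (M *v v) \<le> (\<Sum>i\<in>UNIV. \<Sum>j\<in>UNIV. cmod (M $ i $ j)) * norm v" .
qed

text \<open>The quadratic remainder loses one power of \<open>e\<close> on division; the resonant
  denominator is divided by \<open>e\<close> in just this way, and a linear rate must
  remain.\<close>

lemma difference_quotient_first_order:
  fixes f :: "real \<Rightarrow> real"
  assumes "(\<lambda>e. f e - (a + e * b)) \<in> O[at 0](\<lambda>e. e\<^sup>2)"
  shows "first_order (\<lambda>e. of_real ((f e - a) / e)) (of_real b)"
proof -
  obtain K where "\<forall>\<^sub>F e in at 0. norm (f e - (a + e * b)) \<le> K * norm (e\<^sup>2)"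
    using assms by (elim landau_o.bigE)
  then have "\<forall>\<^sub>F e in at_right 0. norm (f e - (a + e * b)) \<le> K * norm (e\<^sup>2)"
    by (simp add: eventually_at_split)
  then have "\<forall>\<^sub>F e in at_right 0. cmod (of_real ((f e - a) / e) - of_real b) \<le> K * cmod (of_real e)"
    using eventually_at_right_less[of "0::real"]
  proof eventually_elim
    case (elim e)
    have "(f e - a) / e - b = (f e - (a + e * b)) / e"
      using elim by (simp add: field_simps)
    then have "cmod (of_real ((f e - a) / e) - of_real b) = \<bar>f e - (a + e * b)\<bar> / e"
      using elim by (simp only: norm_of_real flip: of_real_diff) simp
    then show ?case using elim by (simp add: divide_le_eq power2_eq_square mult.assoc)
  qed
  then show ?thesis unfolding first_order_def by (rule bigoI)
qed

text \<open>These quotients are the remainders fed into \<open>rank_one_scat_first_order\<close>.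
  The errors are e^2, e^3 and e^2, and the divisors e, e^2 and e, so each quotient is O(e).\<close>

lemma moments_first_order:
  fixes g :: "real \<Rightarrow> real"
  assumes g: "integrable lborel g" "\<forall>t<0. g t = 0" "\<forall>t>1. g t = 0" and k: "k > 0"
  shows "first_order (\<lambda>e. of_real ((cos_moment (k * e) g - (LBINT t. g t)) / e)) 0"
    and "first_order (\<lambda>e. of_real ((sin_moment (k * e) g / e - k * (LBINT t. t * g t)) / e)) 0"
    and "first_order (\<lambda>e. of_real ((self_interaction (k * e) g
      - ((LBINT t. g t) * (LBINT t. t * g t) - (LBINT x. LBINT y. min x y * g x * g y))) / e)) 0"
proof -
  define N where "N = (LBINT t. \<bar>g t\<bar>)"
  show "first_order (\<lambda>e. of_real ((cos_moment (k * e) g - (LBINT t. g t)) / e)) 0"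
  proof (rule first_orderI[of _ _ "k\<^sup>2 / 2 * N"])
    fix e :: real assume e: "0 < e"
    have "\<bar>cos_moment (k * e) g - (LBINT t. g t)\<bar> \<le> (k * e)\<^sup>2 / 2 * N"
      unfolding N_def by (rule cos_moment_small[OF g])
    also have "\<dots> = k\<^sup>2 / 2 * N * e * e" by (simp add: power2_eq_square)
    finally show "cmod (of_real ((cos_moment (k * e) g - (LBINT t. g t)) / e) - 0) \<le> k\<^sup>2 / 2 * N * e"
      using e by (simp only: diff_zero norm_of_real abs_divide) (simp add: divide_le_eq)
  qed
  show "first_order (\<lambda>e. of_real ((sin_moment (k * e) g / e - k * (LBINT t. t * g t)) / e)) 0"
  proof (rule first_orderI[of _ _ "k ^ 3 / 6 * N"])
    fix e :: real assume e: "0 < e"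
    have "\<bar>sin_moment (k * e) g - k * e * (LBINT t. t * g t)\<bar> \<le> (k * e) ^ 3 / 6 * N"
      unfolding N_def by (rule sin_moment_small[OF g]) (use k e in simp)
    also have "\<dots> = k ^ 3 / 6 * N * e * (e * e)" by (simp add: power3_eq_cube)
    finally have *: "\<bar>sin_moment (k * e) g - k * e * (LBINT t. t * g t)\<bar> \<le> k ^ 3 / 6 * N * e * (e * e)" .
    have "(sin_moment (k * e) g / e - k * (LBINT t. t * g t)) / e
        = (sin_moment (k * e) g - k * e * (LBINT t. t * g t)) / (e * e)"
      using e by (simp add: field_simps)
    then have "cmod (of_real ((sin_moment (k * e) g / e - k * (LBINT t. t * g t)) / e) - 0)
        = \<bar>sin_moment (k * e) g - k * e * (LBINT t. t * g t)\<bar> / (e * e)"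
      using e by (simp only: diff_zero norm_of_real abs_divide) simp
    then show "cmod (of_real ((sin_moment (k * e) g / e - k * (LBINT t. t * g t)) / e) - 0) \<le> k ^ 3 / 6 * N * e"
      using e * by (simp add: divide_le_eq)
  qed
  show "first_order (\<lambda>e. of_real ((self_interaction (k * e) g
      - ((LBINT t. g t) * (LBINT t. t * g t) - (LBINT x. LBINT y. min x y * g x * g y))) / e)) 0"
  proof (rule first_orderI[of _ _ "k\<^sup>2 / 6 * N\<^sup>2"])
    fix e :: real assume e: "0 < e"
    have "\<bar>self_interaction (k * e) g - (LBINT x. convolve ramp g x * g x)\<bar> \<le> (k * e)\<^sup>2 / 6 * N\<^sup>2"
      unfolding N_def by (rule self_interaction_small[OF g]) (use k e in simp)
    also have "\<dots> = k\<^sup>2 / 6 * N\<^sup>2 * e * e" by (simp add: power2_eq_square)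
    finally show "cmod (of_real ((self_interaction (k * e) g
      - ((LBINT t. g t) * (LBINT t. t * g t) - (LBINT x. LBINT y. min x y * g x * g y))) / e) - 0) \<le> k\<^sup>2 / 6 * N\<^sup>2 * e"
      unfolding ramp_self_interaction[OF g]
      using e by (simp only: diff_zero norm_of_real abs_divide) (simp add: divide_le_eq)
  qed
qed

theorem theorem5p1:
  fixes V :: "'n::finite \<Rightarrow> real \<Rightarrow> real"
    and lam :: "real \<Rightarrow> real"
    and lam0 lam1 k \<beta> :: real
  assumes "CARD('n) \<ge> 2"
    and "\<forall>i. \<forall>b\<ge>0. set_integrable lborel {0..b} (V i)"
    and "\<forall>i. \<forall>x>1. V i x = 0"
    and "(\<Sum>i\<in>UNIV. LBINT x:{0..}. V i x) = 0"
    and "\<exists>r>0. \<exists>\<Lambda>. \<Lambda> holomorphic_on ball 0 r \<and>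
           (\<forall>x. \<bar>x\<bar> < r \<longrightarrow> \<Lambda> (complex_of_real x) = complex_of_real (lam x))"
    and "lam 0 = lam0"
    and "(\<lambda>e. lam e - (lam0 + e * lam1)) \<in> O[at 0](\<lambda>e. e\<^sup>2)"
    and "lam0 \<noteq> 0" and "lam1 \<noteq> 0"
    and "inj (theta V)"
    and "k > 0"
    and "\<beta> = (if lam0 * A_const V = 1 then 1 / (lam1 * (A_const V)\<^sup>2) else 0)"
  shows "(\<forall>S. is_beta_scat_matrix (theta V) \<beta> k S \<longleftrightarrow> S = scat_limit (theta V) \<beta> k) \<and>
         (\<exists>C. \<forall>eps\<in>{0<..1}.
            (\<exists>S. is_eps_scat_matrix V (lam eps / eps ^ 3) eps k S) \<and>
            (\<forall>S. is_eps_scat_matrix V (lam eps / eps ^ 3) eps k S \<longrightarrow>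
               onorm (\<lambda>v. (S - scat_limit (theta V) \<beta> k) *v v) \<le> C * eps))"
proof (rule conjI)
  note k = \<open>k > 0\<close>
  show "\<forall>S. is_beta_scat_matrix (theta V) \<beta> k S \<longleftrightarrow> S = scat_limit (theta V) \<beta> k"
    using is_beta_scat_matrix_iff[OF assms(10) k] by blast
  \<comment> \<open>\<open>V j\<close> is unrestricted at negative arguments; the extension by zero
    turns half-line integrals into integrals over the line.\<close>
  define g where "g = (\<lambda>j x. indicator {0..} x * V j x)"
  have gV: "g j = (\<lambda>x. indicator {0..1} x *\<^sub>R V j x)" for j
    using assms(3) by (force simp: g_def indicator_def)
  have g: "integrable lborel (g j)" "\<forall>t<0. g j t = 0" "\<forall>t>1. g j t = 0" for j
  proof -
    have "set_integrable lborel {0..1} (V j)" using assms(2) by simp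
    then show "integrable lborel (g j)" by (simp only: gV set_integrable_def)
  qed (simp_all add: gV)
  define v where "v = (\<lambda>j. LBINT t. g j t)"
  define m where "m = (\<lambda>j. LBINT x. LBINT y. min x y * g j x * g j y)"
  have th: "theta V j = (LBINT t. t * g j t)" for j
    by (simp add: theta_def set_lebesgue_integral_def g_def mult_ac)
  have v: "(\<Sum>j\<in>UNIV. v j) = 0"
    using assms(4) by (simp add: v_def g_def set_lebesgue_integral_def)
  have A: "A_const V = - (\<Sum>j\<in>UNIV. m j)"
  proof -
    have "(LBINT x:{0..}. LBINT y:{0..}. min x y * V j x * V j y) = m j" for j
      unfolding m_def set_lebesgue_integral_def g_def
      by (simp add: mult_ac flip: integral_mult_right_zero)
    then show ?thesis by (simp add: A_const_def)
  qed
  define h where "h = (\<lambda>e j t. g j (t / e))"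
  define S where "S = (\<lambda>e. rank_one_scat (lam e / e ^ 3) k (\<lambda>j. cos_moment k (h e j))
    (\<lambda>j. sin_moment k (h e j)) (\<Sum>j\<in>UNIV. self_interaction k (h e j)))"
  have S_iff: "is_eps_scat_matrix V (lam e / e ^ 3) e k T \<longleftrightarrow> T = S e" if e: "e \<in> {0<..1}" for e T
    unfolding S_def
  proof (rule is_eps_scat_matrix_iff[OF k])
    fix j
    show "integrable lborel (h e j)"
      unfolding h_def using lborel_integrable_real_affine[OF g(1)[of j], of "1 / e" 0] e by simp
    show "\<forall>t<0. h e j t = 0"
      using g(2)[of j] e by (simp add: h_def divide_neg_pos)
    have "1 < t / e" if "1 < t" for t
      using that e by (simp add: less_divide_eq)
    then show "\<forall>t>1. h e j t = 0"
      using g(3)[of j] by (simp add: h_def)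
    show "\<forall>t\<ge>0. V j (t / e) = h e j t"
      using e by (simp add: h_def g_def indicator_def)
  qed
  have lim: "first_order (\<lambda>e. S e $ i $ j) (scat_limit (theta V) \<beta> k $ i $ j)" for i j
  proof (rule first_order_cong)
    \<comment> \<open>Each rescaled moment is written as its limit plus \<open>e\<close> times a
      quotient by \<open>e\<close>, which brings the matrix into the shape of the expansion.\<close>
    show "first_order (\<lambda>e. rank_one_scat (lam e / e ^ 3) k
        (\<lambda>j. e * (v j + e * ((cos_moment (k * e) (g j) - v j) / e)))
        (\<lambda>j. e\<^sup>2 * (k * theta V j + e * ((sin_moment (k * e) (g j) / e - k * theta V j) / e)))
        (\<Sum>j\<in>UNIV. e ^ 3 * (v j * theta V j - m j
          + e * ((self_interaction (k * e) (g j) - (v j * theta V j - m j)) / e))) $ i $ j)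
      (scat_limit (theta V) \<beta> k $ i $ j)"
      by (rule rank_one_scat_first_order[OF k v _ _ _ difference_quotient_first_order[OF assms(7)] assms(9) A assms(12)];
          unfold v_def th m_def; rule moments_first_order[OF g k])
    fix e :: real assume e: "0 < e"
    show "rank_one_scat (lam e / e ^ 3) k
        (\<lambda>j. e * (v j + e * ((cos_moment (k * e) (g j) - v j) / e)))
        (\<lambda>j. e\<^sup>2 * (k * theta V j + e * ((sin_moment (k * e) (g j) / e - k * theta V j) / e)))
        (\<Sum>j\<in>UNIV. e ^ 3 * (v j * theta V j - m j
          + e * ((self_interaction (k * e) (g j) - (v j * theta V j - m j)) / e))) $ i $ j = S e $ i $ j"
      unfolding S_def h_def moments_rescale[OF e k] using e by (simp add: power2_eq_square)
  qed
  \<comment> \<open>The entry bound 5 holds whatever the coupling, so the growth of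
    \<open>lam e / e ^ 3\<close> near 0 and possible zeros of the denominator do no harm.\<close>
  have "\<forall>i j. \<exists>K\<ge>0. \<forall>e\<in>{0<..1}. cmod (S e $ i $ j - scat_limit (theta V) \<beta> k $ i $ j) \<le> K * e"
    by (intro allI first_order_uniform_bound[OF lim]) (use rank_one_scat_bound(2)[OF k] in \<open>simp add: S_def\<close>)
  then obtain K where K: "\<And>i j e. e \<in> {0<..1} \<Longrightarrow> cmod (S e $ i $ j - scat_limit (theta V) \<beta> k $ i $ j) \<le> K i j * e"
    by metis
  have "onorm (\<lambda>u. (S e - scat_limit (theta V) \<beta> k) *v u) \<le> (\<Sum>i\<in>UNIV. \<Sum>j\<in>UNIV. K i j) * e"
    if e: "e \<in> {0<..1}" for e
  proof -
    have "onorm (\<lambda>u. (S e - scat_limit (theta V) \<beta> k) *v u)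
        \<le> (\<Sum>i\<in>UNIV. \<Sum>j\<in>UNIV. cmod ((S e - scat_limit (theta V) \<beta> k) $ i $ j))"
      by (rule onorm_matrix_le_sum)
    also have "\<dots> \<le> (\<Sum>i\<in>UNIV. \<Sum>j\<in>UNIV. K i j * e)"
      by (intro sum_mono) (use K[OF e] in simp)
    finally show ?thesis by (simp add: sum_distrib_right)
  qed
  then show "\<exists>C. \<forall>eps\<in>{0<..1}.
      (\<exists>S. is_eps_scat_matrix V (lam eps / eps ^ 3) eps k S) \<and>
      (\<forall>S. is_eps_scat_matrix V (lam eps / eps ^ 3) eps k S \<longrightarrow>
         onorm (\<lambda>v. (S - scat_limit (theta V) \<beta> k) *v v) \<le> C * eps)"
    by (intro exI ballI) (simp only: S_iff, blast)
qed

end
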